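(* Let $\{\beta^t\}_{t\ge0}$ be generated by the method NWB or SNWB (as defined in the context, with $\beta^0\in V$), and let $\beta^\star$ denote the unique minimizer of $\mathcal{L}$ over the restricted subspace $V=\ker(H_\rho)^\perp$. Suppose the Armijo parameter satisfies $\sigma\in(0,1/2)$. Then there exist constants $\delta>0$ and $M>0$ such that for every $t$ with $\|\beta^t-\beta^\star\|\le\delta$ at which the Armijo line search accepts $s^t=1$, $$\|\beta^{t+1}-\beta^\star\|\ \le\ M\,\|\beta^t-\beta^\star\|^2 .$$
   Context: Let $n,m,K\ge 1$ be integers, $[K]=\{1,\dots,K\}$, $\eta,\tau>0$, and let $\Delta_d=\{x\in\mathbb{R}_+^d:\sum_i x_i=1\}$. Let $\mu_k\in\Delta_m$ ($k\in[K]$) have strictly positive entries, $C_k\in\mathbb{R}_+^{n\times m}$, $w_k>0$ with $\sum_{k=1}^K w_k=1$, and $\pi\in\Delta_n$ with strictly positive entries. For $\beta=(\beta_1^\top,\dots,\beta_K^\top)^\top\in\mathbb{R}^{mK}$ with $\beta_k\in\mathbb{R}^m$ define: - $[\alpha_k(\beta_k)]_i=-\eta\log\big(\sum_{j=1}^m[\mu_k]_j\exp(([\beta_k]_j-[C_k]_{ij})/\eta)\big)$ for $i\in[n]$, and $\Phi(\beta)=\sum_{k=1}^K w_k\alpha_k(\beta_k)\in\mathbb{R}^n$; - $\mathcal{L}(\beta)=-\sum_{k=1}^K w_k\langle\beta_k,\mu_k\rangle+\tau\log\big(\sum_{i=1}^n\pi_i\exp(-[\Phi(\beta)]_i/\tau)\big)$;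 - $v=v(\beta)\in\Delta_n$, $v_i=\pi_i\exp(-[\Phi(\beta)]_i/\tau)\big/\sum_{l=1}^n\pi_l\exp(-[\Phi(\beta)]_l/\tau)$; - $P_k=P_k(\beta_k)\in\mathbb{R}^{n\times m}$, $[P_k]_{ij}=\dfrac{[\mu_k]_j\exp(([\beta_k]_j-[C_k]_{ij})/\eta)}{\sum_{l=1}^m[\mu_k]_l\exp(([\beta_k]_l-[C_k]_{il})/\eta)}$ (row-stochastic). The gradient $g=\nabla\mathcal{L}(\beta)$ has blocks $g_k=w_k(P_k^\top v-\mu_k)$. Sparsification with threshold $\rho\ge 0$: fix $i^\star\in\arg\max_{i\in[n]}v_i$. Put $[P_{k,\rho}]_{i^\star j}=[P_k]_{i^\star j}$ for all $j$ and, for $i\neq i^\star$, $$[P_{k,\rho}]_{ij}=\frac{[P_k]_{ij}\,\mathbf{1}\{[P_k]_{ij}\ge\rho\}}{\sum_{l=1}^m[P_k]_{il}\,\mathbf{1}\{[P_k]_{il}\ge\rho\}}.$$ It is assumed, whenever $P_{k,\rho}$ is used, that these denominators are nonzero, so $P_{k,\rho}$ is row-stochastic. Let $\gamma_{k,\rho}=P_{k,\rho}^\top v$. The sparsified Hessian $H_\rho=H_\rho(\beta)$ has $m\times m$ blocks $$[H_\rho]_{kr}=\tfrac{w_kw_r}{\tau}\big(P_{k,\rho}^\top\mathrm{diag}(v)P_{r,\rho}-\gamma_{k,\rho}\gamma_{r,\rho}^\top\big)+\mathbf{1}\{k=r\}\,\tfrac{w_k}{\eta}\big(\mathrm{diag}(\gamma_{k,\rho})-P_{k,\rho}^\top\mathrm{diag}(v)P_{k,\rho}\big),$$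 and $H_0=\nabla^2\mathcal{L}(\beta)$. The kernel of $H_\rho(\beta)$ does not depend on $\beta$ or $\rho$: it is the space of vectors whose blocks are constant, so $V=\ker(H_\rho)^\perp=\{\beta\in\mathbb{R}^{mK}:\sum_{j=1}^m[\beta_k]_j=0\ \forall k\in[K]\}$. Methods. The initial point $\beta^0$ is normalized so that $\beta^0\in V$. Fix $C_\rho\ge0$: $C_\rho=0$ for NWB (the exact Newton method), $C_\rho>0$ for SNWB (the sparse Newton method). Fix $\sigma,c\in(0,1)$. At iteration $t$, let $g^t=\nabla\mathcal{L}(\beta^t)$, $\rho^t=C_\rho\|g^t\|$, $H_\rho^t=H_{\rho^t}(\beta^t)$; let $\Delta\beta^t=-(H_\rho^t+\|g^t\|I)^{-1}g^t$ (exact solution; $\Delta\beta^t=0$ if $g^t=0$); let $s^t$ be the first element of $1,c,c^2,\dots$ satisfying the Armijo condition $\mathcal{L}(\beta^t+s\Delta\beta^t)\le\mathcal{L}(\beta^t)+\sigma s\,(g^t)^\top\Delta\beta^t$; set $\beta^{t+1}=\beta^t+s^t\Delta\beta^t$. Here $\|\cdot\|$ is the Euclidean norm. *)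

theory Defs
  imports "HOL-Analysis.Analysis"
begin

text \<open>
  The index sets \<open>[n]\<close>, \<open>[m]\<close>, \<open>[K]\<close> are the finite types \<open>'n\<close>, \<open>'m\<close>, \<open>'k\<close>. A stacked vector
  \<open>\<beta> = (\<beta>\<^sub>1, \<dots>, \<beta>\<^sub>K)\<close> of dimension \<open>mK\<close> is an element of \<open>real ^ ('k \<times> 'm)\<close>, so that \<open>norm\<close>
  is its Euclidean norm and Hessians are ordinary square matrices over \<open>'k \<times> 'm\<close>.
\<close>

definition prob_simplex :: "(real ^ 'd) set" where
  "prob_simplex = {x. (\<forall>i. 0 \<le> x $ i) \<and> (\<Sum>i\<in>UNIV. x $ i) = 1}"

definition blk :: "'k \<Rightarrow> real ^ ('k::finite \<times> 'm::finite) \<Rightarrow> real ^ 'm" where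
  "blk k \<beta> = (\<chi> j. \<beta> $ (k, j))"

definition diag_mat :: "real ^ 'd \<Rightarrow> real ^ 'd ^ 'd" where
  "diag_mat x = (\<chi> i j. if i = j then x $ i else 0)"

definition outer :: "real ^ 'd \<Rightarrow> real ^ 'e \<Rightarrow> real ^ 'e ^ 'd" where
  "outer x y = (\<chi> i j. x $ i * y $ j)"

text \<open>Meaningful only where \<open>f\<close> is differentiable; for \<open>dual_loss\<close> this is \<open>GDERIV_dual_loss\<close> below,
  which also gives the blocks \<open>w\<^sub>k (P\<^sub>k\<^sup>T v - \<mu>\<^sub>k)\<close>.\<close>

definition gradient :: "('a::real_inner \<Rightarrow> real) \<Rightarrow> 'a \<Rightarrow> 'a" where
  "gradient f x = (THE g. GDERIV f x :> g)"

definition alpha :: "real \<Rightarrow> real ^ 'm \<Rightarrow> real ^ 'm ^ 'n \<Rightarrow> real ^ 'm \<Rightarrow> real ^ 'n" where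
  "alpha \<eta> \<mu>k Ck b =
     (\<chi> i. - \<eta> * ln (\<Sum>j\<in>UNIV. \<mu>k $ j * exp ((b $ j - Ck $ i $ j) / \<eta>)))"

definition Phi :: "real \<Rightarrow> ('k \<Rightarrow> real ^ 'm) \<Rightarrow> ('k \<Rightarrow> real ^ 'm ^ 'n) \<Rightarrow> ('k \<Rightarrow> real)
    \<Rightarrow> real ^ ('k::finite \<times> 'm::finite) \<Rightarrow> real ^ 'n" where
  "Phi \<eta> \<mu> C w \<beta> = (\<Sum>k\<in>UNIV. w k *\<^sub>R alpha \<eta> (\<mu> k) (C k) (blk k \<beta>))"

definition dual_loss :: "real \<Rightarrow> real \<Rightarrow> ('k \<Rightarrow> real ^ 'm) \<Rightarrow> ('k \<Rightarrow> real ^ 'm ^ 'n) \<Rightarrow> ('k \<Rightarrow> real)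
    \<Rightarrow> real ^ 'n \<Rightarrow> real ^ ('k::finite \<times> 'm::finite) \<Rightarrow> real" where
  "dual_loss \<eta> \<tau> \<mu> C w \<pi> \<beta> =
     - (\<Sum>k\<in>UNIV. w k * (blk k \<beta> \<bullet> \<mu> k))
     + \<tau> * ln (\<Sum>i\<in>UNIV. \<pi> $ i * exp (- Phi \<eta> \<mu> C w \<beta> $ i / \<tau>))"

definition bary_weights :: "real \<Rightarrow> real \<Rightarrow> ('k \<Rightarrow> real ^ 'm) \<Rightarrow> ('k \<Rightarrow> real ^ 'm ^ 'n) \<Rightarrow> ('k \<Rightarrow> real)
    \<Rightarrow> real ^ 'n \<Rightarrow> real ^ ('k::finite \<times> 'm::finite) \<Rightarrow> real ^ 'n" where
  "bary_weights \<eta> \<tau> \<mu> C w \<pi> \<beta> =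
     (\<chi> i. \<pi> $ i * exp (- Phi \<eta> \<mu> C w \<beta> $ i / \<tau>)
            / (\<Sum>l\<in>UNIV. \<pi> $ l * exp (- Phi \<eta> \<mu> C w \<beta> $ l / \<tau>)))"

definition plan :: "real \<Rightarrow> real ^ 'm \<Rightarrow> real ^ 'm ^ 'n \<Rightarrow> real ^ 'm \<Rightarrow> real ^ 'm ^ 'n" where
  "plan \<eta> \<mu>k Ck b =
     (\<chi> i j. \<mu>k $ j * exp ((b $ j - Ck $ i $ j) / \<eta>)
              / (\<Sum>l\<in>UNIV. \<mu>k $ l * exp ((b $ l - Ck $ i $ l) / \<eta>)))"

definition kept_mass :: "real \<Rightarrow> real ^ 'm ^ 'n \<Rightarrow> 'n \<Rightarrow> real" where
  "kept_mass \<rho> P i = (\<Sum>l\<in>UNIV. P $ i $ l * of_bool (\<rho> \<le> P $ i $ l))"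

definition sparsify :: "real \<Rightarrow> 'n \<Rightarrow> real ^ 'm ^ 'n \<Rightarrow> real ^ 'm ^ 'n" where
  "sparsify \<rho> istar P =
     (\<chi> i j. if i = istar then P $ i $ j
              else P $ i $ j * of_bool (\<rho> \<le> P $ i $ j) / kept_mass \<rho> P i)"

text \<open>The \<open>(k, r)\<close> block of \<open>H\<^sub>\<rho>\<close>; here \<open>P k\<close> is the already sparsified plan.\<close>

definition hess_block :: "real \<Rightarrow> real \<Rightarrow> ('k \<Rightarrow> real) \<Rightarrow> real ^ 'n \<Rightarrow> ('k \<Rightarrow> real ^ 'm ^ 'n)
    \<Rightarrow> 'k \<Rightarrow> 'k \<Rightarrow> real ^ 'm ^ 'm" where
  "hess_block \<eta> \<tau> w v P k r =
     (w k * w r / \<tau>) *\<^sub>R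
        (transpose (P k) ** diag_mat v ** P r
           - outer (transpose (P k) *v v) (transpose (P r) *v v))
     + (if k = r
        then (w k / \<eta>) *\<^sub>R
               (diag_mat (transpose (P k) *v v) - transpose (P k) ** diag_mat v ** P k)
        else 0)"

definition sparse_hessian :: "real \<Rightarrow> real \<Rightarrow> ('k \<Rightarrow> real ^ 'm) \<Rightarrow> ('k \<Rightarrow> real ^ 'm ^ 'n) \<Rightarrow> ('k \<Rightarrow> real)
    \<Rightarrow> real ^ 'n \<Rightarrow> real \<Rightarrow> 'n \<Rightarrow> real ^ ('k::finite \<times> 'm::finite) \<Rightarrow> real ^ ('k \<times> 'm) ^ ('k \<times> 'm)" where
  "sparse_hessian \<eta> \<tau> \<mu> C w \<pi> \<rho> istar \<beta> =
     (\<chi> a b. hess_block \<eta> \<tau> w (bary_weights \<eta> \<tau> \<mu> C w \<pi> \<beta>)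
                (\<lambda>k. sparsify \<rho> istar (plan \<eta> (\<mu> k) (C k) (blk k \<beta>)))
                (fst a) (fst b) $ snd a $ snd b)"

text \<open>\<open>V\<close> is the orthogonal complement of the kernel of \<open>sparse_hessian\<close>:
  see \<open>V_eq_orthogonal_comp_kernel\<close> below.\<close>

definition V :: "(real ^ ('k::finite \<times> 'm::finite)) set" where
  "V = {\<beta>. \<forall>k. (\<Sum>j\<in>UNIV. blk k \<beta> $ j) = 0}"

definition newton_dir :: "real ^ 'd \<Rightarrow> real ^ 'd ^ 'd \<Rightarrow> real ^ 'd" where
  "newton_dir g H =
     (if g = 0 then 0 else - (matrix_inv (H + norm g *\<^sub>R mat 1) *v g))"

definition armijo :: "('a::real_inner \<Rightarrow> real) \<Rightarrow> real \<Rightarrow> 'a \<Rightarrow> 'a \<Rightarrow> real \<Rightarrow> bool" where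
  "armijo f \<sigma> x d s \<longleftrightarrow> f (x + s *\<^sub>R d) \<le> f x + \<sigma> * s * (gradient f x \<bullet> d)"

text \<open>
  \<open>newton_wb_iterates \<eta> \<tau> \<mu> C w \<pi> C\<rho> \<sigma> c istar s \<beta>\<close>: \<open>\<beta>\<close> is a sequence of iterates, with accepted
  step sizes \<open>s\<close>, of NWB (\<open>C\<rho> = 0\<close>) or SNWB (\<open>C\<rho> > 0\<close>). The index \<open>istar t\<close> is the choice made in
  iteration \<open>t\<close> of a maximizer of the weights (ties are broken arbitrarily). The second clause of
  the step is the standing assumption that the row normalizations in the sparsification are defined.
\<close>

definition newton_wb_iterates :: "real \<Rightarrow> real \<Rightarrow> ('k \<Rightarrow> real ^ 'm) \<Rightarrow> ('k \<Rightarrow> real ^ 'm ^ 'n)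
    \<Rightarrow> ('k \<Rightarrow> real) \<Rightarrow> real ^ 'n \<Rightarrow> real \<Rightarrow> real \<Rightarrow> real
    \<Rightarrow> (nat \<Rightarrow> 'n) \<Rightarrow> (nat \<Rightarrow> real) \<Rightarrow> (nat \<Rightarrow> real ^ ('k::finite \<times> 'm::finite)) \<Rightarrow> bool" where
  "newton_wb_iterates \<eta> \<tau> \<mu> C w \<pi> C\<rho> \<sigma> c istar s \<beta> \<longleftrightarrow>
     \<beta> 0 \<in> V \<and>
     (\<forall>t. let L = dual_loss \<eta> \<tau> \<mu> C w \<pi>;
              v = bary_weights \<eta> \<tau> \<mu> C w \<pi> (\<beta> t);
              g = gradient L (\<beta> t);
              \<rho> = C\<rho> * norm g;
              d = newton_dir g (sparse_hessian \<eta> \<tau> \<mu> C w \<pi> \<rho> (istar t) (\<beta> t))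
          in (\<forall>i. v $ i \<le> v $ istar t) \<and>
             (\<forall>k i. i \<noteq> istar t \<longrightarrow> kept_mass \<rho> (plan \<eta> (\<mu> k) (C k) (blk k (\<beta> t))) i \<noteq> 0) \<and>
             (\<exists>q. s t = c ^ q \<and> armijo L \<sigma> (\<beta> t) d (c ^ q) \<and>
                  (\<forall>p<q. \<not> armijo L \<sigma> (\<beta> t) d (c ^ p))) \<and>
             \<beta> (Suc t) = \<beta> t + s t *\<^sub>R d)"


subsection \<open>The gradient and the kernel in closed form\<close>

lemma gradient_eqI:
  assumes "GDERIV f x :> g"
  shows "gradient f x = g"
  unfolding gradient_def
proof (rule the_equality)
  show "GDERIV f x :> g" by fact
next
  fix h assume "GDERIV f x :> h"
  then have "(\<lambda>y. y \<bullet> h) = (\<lambda>y. y \<bullet> g)"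
    using assms unfolding gderiv_def by (rule has_derivative_unique)
  then have "(h - g) \<bullet> h = (h - g) \<bullet> g" by metis
  then have "(h - g) \<bullet> (h - g) = 0" by (simp add: inner_diff_right)
  then show "h = g" by simp
qed

lemma sum_pos_UNIV:
  fixes f :: "'d::finite \<Rightarrow> real"
  assumes "\<And>i. 0 < f i"
  shows "0 < (\<Sum>i\<in>UNIV. f i)"
  using assms by (intro sum_pos) auto

lemma sum_prod_UNIV:
  fixes f :: "'k::finite \<times> 'm::finite \<Rightarrow> real"
  shows "(\<Sum>a\<in>UNIV. f a) = (\<Sum>k\<in>UNIV. \<Sum>j\<in>UNIV. f (k, j))"
  by (simp add: UNIV_Times_UNIV[symmetric] sum.cartesian_product del: UNIV_Times_UNIV)

lemma GDERIV_dual_loss: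
  fixes \<mu> :: "'k::finite \<Rightarrow> real ^ 'm::finite" and C :: "'k \<Rightarrow> real ^ 'm ^ 'n::finite"
  assumes pos: "\<eta> > 0" "\<tau> > 0" "\<And>k j. 0 < \<mu> k $ j" "\<And>i. 0 < \<pi> $ i"
  shows "GDERIV (dual_loss \<eta> \<tau> \<mu> C w \<pi>) \<beta> :>
    (\<chi> a. (w (fst a) *\<^sub>R
       (transpose (plan \<eta> (\<mu> (fst a)) (C (fst a)) (blk (fst a) \<beta>)) *v
          bary_weights \<eta> \<tau> \<mu> C w \<pi> \<beta> - \<mu> (fst a))) $ snd a)"
proof -
  let ?P = "\<lambda>k. plan \<eta> (\<mu> k) (C k) (blk k \<beta>)"
  let ?v = "bary_weights \<eta> \<tau> \<mu> C w \<pi> \<beta>"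
  let ?Phi = "\<lambda>i \<beta>. Phi \<eta> \<mu> C w \<beta> $ i"
  have dal: "((\<lambda>\<beta>. alpha \<eta> (\<mu> k) (C k) (blk k \<beta>) $ i)
      has_derivative (\<lambda>h. - (\<Sum>j\<in>UNIV. ?P k $ i $ j * h $ (k, j)))) (at \<beta>)" for k i
  proof -
    let ?Z = "\<Sum>j\<in>UNIV. \<mu> k $ j * exp ((\<beta> $ (k, j) - C k $ i $ j) / \<eta>)"
    have Z: "?Z > 0" using pos by (intro sum_pos_UNIV mult_pos_pos) auto
    have "((\<lambda>\<beta>. - \<eta> * ln (\<Sum>j\<in>UNIV. \<mu> k $ j * exp ((\<beta> $ (k, j) - C k $ i $ j) / \<eta>)))
      has_derivative (\<lambda>h. - \<eta> * ((\<Sum>j\<in>UNIV. \<mu> k $ j *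
          (exp ((\<beta> $ (k, j) - C k $ i $ j) / \<eta>) * (h $ (k, j) / \<eta>))) / ?Z))) (at \<beta>)"
      using Z pos
      by (auto intro!: derivative_eq_intros bounded_linear.has_derivative[OF bounded_linear_vec_nth]
          simp: field_simps)
    moreover have "- \<eta> * ((\<Sum>j\<in>UNIV. \<mu> k $ j *
          (exp ((\<beta> $ (k, j) - C k $ i $ j) / \<eta>) * (h $ (k, j) / \<eta>))) / ?Z)
        = - (\<Sum>j\<in>UNIV. ?P k $ i $ j * h $ (k, j))" for h
    proof -
      have num: "(\<Sum>j\<in>UNIV. \<mu> k $ j * (exp ((\<beta> $ (k, j) - C k $ i $ j) / \<eta>) * (h $ (k, j) / \<eta>)))
          = (\<Sum>j\<in>UNIV. \<mu> k $ j * exp ((\<beta> $ (k, j) - C k $ i $ j) / \<eta>) * h $ (k, j)) / \<eta>"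
        by (simp add: sum_divide_distrib mult.assoc)
      have "(\<Sum>j\<in>UNIV. ?P k $ i $ j * h $ (k, j))
          = (\<Sum>j\<in>UNIV. \<mu> k $ j * exp ((\<beta> $ (k, j) - C k $ i $ j) / \<eta>) * h $ (k, j)) / ?Z"
        by (simp add: plan_def blk_def sum_divide_distrib)
      then show ?thesis unfolding num using pos by simp
    qed
    ultimately show ?thesis by (simp add: alpha_def blk_def)
  qed
  have dPhi: "(?Phi i has_derivative
      (\<lambda>h. - (\<Sum>k\<in>UNIV. w k * (\<Sum>j\<in>UNIV. ?P k $ i $ j * h $ (k, j))))) (at \<beta>)" for i
  proof -
    have "((\<lambda>\<beta>. \<Sum>k\<in>UNIV. w k * alpha \<eta> (\<mu> k) (C k) (blk k \<beta>) $ i) has_derivative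
      (\<lambda>h. \<Sum>k\<in>UNIV. w k * - (\<Sum>j\<in>UNIV. ?P k $ i $ j * h $ (k, j)))) (at \<beta>)"
      by (intro has_derivative_sum has_derivative_mult_right dal)
    then show ?thesis by (simp add: Phi_def sum_negf)
  qed
  let ?W = "\<Sum>i\<in>UNIV. \<pi> $ i * exp (- ?Phi i \<beta> / \<tau>)"
  have W: "?W > 0" using pos by (intro sum_pos_UNIV mult_pos_pos) auto
  let ?S = "\<lambda>h i. \<Sum>k\<in>UNIV. w k * (\<Sum>j\<in>UNIV. ?P k $ i $ j * h $ (k, j))"
  have "((\<lambda>\<beta>. \<tau> * ln (\<Sum>i\<in>UNIV. \<pi> $ i * exp (- ?Phi i \<beta> / \<tau>))) has_derivative
     (\<lambda>h. \<tau> * ((\<Sum>i\<in>UNIV. \<pi> $ i * (exp (- ?Phi i \<beta> / \<tau>) * (?S h i / \<tau>))) / ?W))) (at \<beta>)"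
    using W pos
    by (auto intro!: derivative_eq_intros dPhi simp: field_simps)
  moreover have "\<tau> * ((\<Sum>i\<in>UNIV. \<pi> $ i * (exp (- ?Phi i \<beta> / \<tau>) * (?S h i / \<tau>))) / ?W)
      = (\<Sum>i\<in>UNIV. ?v $ i * ?S h i)" for h
  proof -
    have num: "(\<Sum>i\<in>UNIV. \<pi> $ i * (exp (- ?Phi i \<beta> / \<tau>) * (?S h i / \<tau>)))
        = (\<Sum>i\<in>UNIV. \<pi> $ i * exp (- ?Phi i \<beta> / \<tau>) * ?S h i) / \<tau>"
      unfolding sum_divide_distrib[where r = \<tau> and A = "UNIV :: 'n set"]
      by (intro sum.cong refl) simp
    have "(\<Sum>i\<in>UNIV. ?v $ i * ?S h i)
        = (\<Sum>i\<in>UNIV. \<pi> $ i * exp (- ?Phi i \<beta> / \<tau>) * ?S h i) / ?W"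
      by (simp only: bary_weights_def vec_lambda_beta sum_divide_distrib times_divide_eq_left)
    then show ?thesis unfolding num using pos by simp
  qed
  ultimately have d1: "((\<lambda>\<beta>. \<tau> * ln (\<Sum>i\<in>UNIV. \<pi> $ i * exp (- ?Phi i \<beta> / \<tau>))) has_derivative
     (\<lambda>h. \<Sum>i\<in>UNIV. ?v $ i * ?S h i)) (at \<beta>)" by simp
  have d2: "((\<lambda>\<beta>. - (\<Sum>k\<in>UNIV. w k * (blk k \<beta> \<bullet> \<mu> k))) has_derivative
     (\<lambda>h. - (\<Sum>k\<in>UNIV. w k * (\<Sum>j\<in>UNIV. h $ (k, j) * \<mu> k $ j)))) (at \<beta>)"
    unfolding inner_vec_def blk_def inner_real_def vec_lambda_beta
    by (intro has_derivative_minus has_derivative_sum has_derivative_mult_right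
        has_derivative_mult_left bounded_linear_imp_has_derivative bounded_linear_vec_nth)
  have swap: "(\<Sum>i\<in>UNIV. ?v $ i * ?S h i)
      = (\<Sum>k\<in>UNIV. w k * (\<Sum>j\<in>UNIV. h $ (k, j) * (\<Sum>i\<in>UNIV. ?P k $ i $ j * ?v $ i)))" for h
  proof -
    have "(\<Sum>i\<in>UNIV. ?v $ i * ?S h i)
        = (\<Sum>i\<in>UNIV. \<Sum>k\<in>UNIV. \<Sum>j\<in>UNIV. w k * h $ (k, j) * ?P k $ i $ j * ?v $ i)"
      by (simp add: sum_distrib_left mult_ac)
    also have "\<dots> = (\<Sum>k\<in>UNIV. \<Sum>i\<in>UNIV. \<Sum>j\<in>UNIV. w k * h $ (k, j) * ?P k $ i $ j * ?v $ i)"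
      by (rule sum.swap)
    also have "\<dots> = (\<Sum>k\<in>UNIV. \<Sum>j\<in>UNIV. \<Sum>i\<in>UNIV. w k * h $ (k, j) * ?P k $ i $ j * ?v $ i)"
      by (intro sum.cong refl sum.swap)
    finally show ?thesis by (simp add: sum_distrib_left mult_ac)
  qed
  show ?thesis
    unfolding gderiv_def
    apply (rule has_derivative_eq_rhs)
    unfolding dual_loss_def
     apply (rule has_derivative_add[OF d2 d1])
    unfolding swap
    apply (rule ext)
    apply (simp add: inner_vec_def sum_prod_UNIV matrix_vector_mult_def transpose_def
        algebra_simps sum_subtractf sum_distrib_left)
    done
qed

lemma sparse_hessian_mult_nth:
  fixes \<mu> :: "'k::finite \<Rightarrow> real ^ 'm::finite" and C :: "'k \<Rightarrow> real ^ 'm ^ 'n::finite"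
    and w :: "'k \<Rightarrow> real" and \<pi> :: "real ^ 'n" and \<eta> \<tau> \<rho> :: real and istar :: 'n
    and \<beta> x :: "real ^ ('k \<times> 'm)"
  defines "H \<equiv> sparse_hessian \<eta> \<tau> \<mu> C w \<pi> \<rho> istar \<beta>"
    and "v \<equiv> bary_weights \<eta> \<tau> \<mu> C w \<pi> \<beta>"
    and "Q \<equiv> \<lambda>k. sparsify \<rho> istar (plan \<eta> (\<mu> k) (C k) (blk k \<beta>))"
  defines "y \<equiv> \<lambda>x k i. \<Sum>j\<in>UNIV. Q k $ i $ j * x $ (k, j)"
  defines "S \<equiv> \<lambda>x i. \<Sum>k\<in>UNIV. w k * y x k i"
  shows "(H *v x) $ (k, j) =
      w k / \<tau> * (\<Sum>i\<in>UNIV. v $ i * Q k $ i $ j * (S x i - (\<Sum>l\<in>UNIV. v $ l * S x l)))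
    + w k / \<eta> * (\<Sum>i\<in>UNIV. v $ i * Q k $ i $ j * (x $ (k, j) - y x k i))"
proof -
  have PDP: "(transpose (Q k) ** diag_mat v ** Q r) $ j $ l
      = (\<Sum>i\<in>UNIV. v $ i * Q k $ i $ j * Q r $ i $ l)" for r l
    by (simp add: matrix_matrix_mult_def transpose_def diag_mat_def if_distrib cong: if_cong)
       (simp add: mult_ac)
  have gam: "(transpose (Q r) *v v) $ l = (\<Sum>i\<in>UNIV. v $ i * Q r $ i $ l)" for r l
    by (simp add: matrix_vector_mult_def transpose_def mult_ac)
  have gx: "(\<Sum>l\<in>UNIV. (transpose (Q r) *v v) $ l * x $ (r, l)) = (\<Sum>i\<in>UNIV. v $ i * y x r i)" for r
  proof -
    have "(\<Sum>l\<in>UNIV. (transpose (Q r) *v v) $ l * x $ (r, l))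
        = (\<Sum>l\<in>UNIV. \<Sum>i\<in>UNIV. v $ i * Q r $ i $ l * x $ (r, l))"
      by (simp only: gam sum_distrib_right)
    also have "\<dots> = (\<Sum>i\<in>UNIV. \<Sum>l\<in>UNIV. v $ i * Q r $ i $ l * x $ (r, l))"
      by (rule sum.swap)
    finally show ?thesis by (simp add: y_def sum_distrib_left mult_ac)
  qed
  have Px: "(\<Sum>l\<in>UNIV. (transpose (Q k) ** diag_mat v ** Q r) $ j $ l * x $ (r, l))
      = (\<Sum>i\<in>UNIV. v $ i * Q k $ i $ j * y x r i)" for r
  proof -
    have "(\<Sum>l\<in>UNIV. (transpose (Q k) ** diag_mat v ** Q r) $ j $ l * x $ (r, l))
        = (\<Sum>l\<in>UNIV. \<Sum>i\<in>UNIV. v $ i * Q k $ i $ j * Q r $ i $ l * x $ (r, l))"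
      by (simp add: PDP sum_distrib_right)
    also have "\<dots> = (\<Sum>i\<in>UNIV. \<Sum>l\<in>UNIV. v $ i * Q k $ i $ j * Q r $ i $ l * x $ (r, l))"
      by (rule sum.swap)
    finally show ?thesis by (simp add: y_def sum_distrib_left mult_ac)
  qed
  define A where "A r = (\<Sum>i\<in>UNIV. v $ i * Q k $ i $ j * y x r i)" for r
  define g where "g = (\<Sum>i\<in>UNIV. v $ i * Q k $ i $ j)"
  define B where "B r = (\<Sum>i\<in>UNIV. v $ i * y x r i)" for r
  have blkr: "(\<Sum>l\<in>UNIV. hess_block \<eta> \<tau> w v Q k r $ j $ l * x $ (r, l))
     = w k / \<tau> * (w r * A r - g * (w r * B r))
       + (if k = r then w k / \<eta> * (g * x $ (k, j) - A k) else 0)" for r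
  proof -
    have 1: "(\<Sum>l\<in>UNIV. ((w k * w r / \<tau>) *\<^sub>R
        (transpose (Q k) ** diag_mat v ** Q r
           - outer (transpose (Q k) *v v) (transpose (Q r) *v v))) $ j $ l * x $ (r, l))
       = w k * w r / \<tau> * (A r - g * B r)"
    proof -
      have "(\<Sum>l\<in>UNIV. ((w k * w r / \<tau>) *\<^sub>R
        (transpose (Q k) ** diag_mat v ** Q r
           - outer (transpose (Q k) *v v) (transpose (Q r) *v v))) $ j $ l * x $ (r, l))
       = w k * w r / \<tau> * ((\<Sum>l\<in>UNIV. (transpose (Q k) ** diag_mat v ** Q r) $ j $ l * x $ (r, l))
           - (transpose (Q k) *v v) $ j * (\<Sum>l\<in>UNIV. (transpose (Q r) *v v) $ l * x $ (r, l)))"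
        unfolding sum_distrib_left sum_subtractf[symmetric]
        by (intro sum.cong refl) (simp add: outer_def algebra_simps)
      then show ?thesis unfolding Px gx unfolding gam A_def B_def g_def .
    qed
    have 2: "(\<Sum>l\<in>UNIV. ((w k / \<eta>) *\<^sub>R
               (diag_mat (transpose (Q k) *v v) - transpose (Q k) ** diag_mat v ** Q k)) $ j $ l * x $ (k, l))
       = w k / \<eta> * (g * x $ (k, j) - A k)"
    proof -
      have "(\<Sum>l\<in>UNIV. ((w k / \<eta>) *\<^sub>R
               (diag_mat (transpose (Q k) *v v) - transpose (Q k) ** diag_mat v ** Q k)) $ j $ l * x $ (k, l))
        = w k / \<eta> * ((\<Sum>l\<in>UNIV. diag_mat (transpose (Q k) *v v) $ j $ l * x $ (k, l))
            - (\<Sum>l\<in>UNIV. (transpose (Q k) ** diag_mat v ** Q k) $ j $ l * x $ (k, l)))"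
        unfolding sum_distrib_left sum_subtractf[symmetric]
        by (intro sum.cong refl) (simp add: algebra_simps)
      moreover have "(\<Sum>l\<in>UNIV. diag_mat (transpose (Q k) *v v) $ j $ l * x $ (k, l)) = g * x $ (k, j)"
        unfolding diag_mat_def vec_lambda_beta gam g_def
        by (simp add: if_distrib[of "\<lambda>z. z * _"] cong: if_cong)
      ultimately show ?thesis unfolding Px A_def by simp
    qed
    show ?thesis
    proof (cases "k = r")
      case True
      then show ?thesis using 1 2
        by (simp add: hess_block_def distrib_right sum.distrib del: vector_scaleR_component)
           (simp add: algebra_simps)
    next
      case False
      then show ?thesis using 1
        by (simp add: hess_block_def del: vector_scaleR_component) (simp add: algebra_simps)
    qed
  qed
  have "(H *v x) $ (k, j) = (\<Sum>r\<in>UNIV. \<Sum>l\<in>UNIV. hess_block \<eta> \<tau> w v Q k r $ j $ l * x $ (r, l))"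
    by (simp add: H_def v_def Q_def sparse_hessian_def matrix_vector_mult_def sum_prod_UNIV)
  also have "\<dots> = w k / \<tau> * ((\<Sum>r\<in>UNIV. w r * A r) - g * (\<Sum>r\<in>UNIV. w r * B r))
       + w k / \<eta> * (g * x $ (k, j) - A k)"
    unfolding blkr
    by (simp add: sum.distrib sum_subtractf sum_distrib_left[symmetric] sum_divide_distrib[symmetric])
  also have "(\<Sum>r\<in>UNIV. w r * A r) = (\<Sum>i\<in>UNIV. v $ i * Q k $ i $ j * S x i)"
  proof -
    have "(\<Sum>r\<in>UNIV. w r * A r) = (\<Sum>r\<in>UNIV. \<Sum>i\<in>UNIV. v $ i * Q k $ i $ j * (w r * y x r i))"
      by (simp add: A_def sum_distrib_left mult_ac)
    also have "\<dots> = (\<Sum>i\<in>UNIV. \<Sum>r\<in>UNIV. v $ i * Q k $ i $ j * (w r * y x r i))"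
      by (rule sum.swap)
    finally show ?thesis by (simp add: S_def sum_distrib_left)
  qed
  also have "(\<Sum>r\<in>UNIV. w r * B r) = (\<Sum>i\<in>UNIV. v $ i * S x i)"
  proof -
    have "(\<Sum>r\<in>UNIV. w r * B r) = (\<Sum>r\<in>UNIV. \<Sum>i\<in>UNIV. v $ i * (w r * y x r i))"
      by (simp add: B_def sum_distrib_left mult_ac)
    also have "\<dots> = (\<Sum>i\<in>UNIV. \<Sum>r\<in>UNIV. v $ i * (w r * y x r i))"
      by (rule sum.swap)
    finally show ?thesis by (simp add: S_def sum_distrib_left)
  qed
  finally show ?thesis
    by (simp add: g_def A_def right_diff_distrib sum_subtractf sum_distrib_right[symmetric])
qed

lemma kernel_sparse_hessian:
  fixes \<mu> :: "'k::finite \<Rightarrow> real ^ 'm::finite" and C :: "'k \<Rightarrow> real ^ 'm ^ 'n::finite"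
  assumes pos: "\<eta> > 0" "\<tau> > 0" "\<And>k j. 0 < \<mu> k $ j" "\<And>i. 0 < \<pi> $ i" "\<And>k. 0 < w k"
    and den: "\<And>k i. i \<noteq> istar \<Longrightarrow> kept_mass \<rho> (plan \<eta> (\<mu> k) (C k) (blk k \<beta>)) i \<noteq> 0"
  shows "{x. sparse_hessian \<eta> \<tau> \<mu> C w \<pi> \<rho> istar \<beta> *v x = 0}
       = {x. \<forall>k j l. x $ (k, j) = x $ (k, l)}"
proof -
  let ?H = "sparse_hessian \<eta> \<tau> \<mu> C w \<pi> \<rho> istar \<beta>"
  define v where "v = bary_weights \<eta> \<tau> \<mu> C w \<pi> \<beta>"
  define Q where "Q = (\<lambda>k. sparsify \<rho> istar (plan \<eta> (\<mu> k) (C k) (blk k \<beta>)))"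
  define y where "y = (\<lambda>x k i. \<Sum>j\<in>UNIV. Q k $ i $ j * x $ (k, j))"
  define S where "S = (\<lambda>x i. \<Sum>k\<in>UNIV. w k * y x k i)"
  have W: "(\<Sum>l\<in>UNIV. \<pi> $ l * exp (- Phi \<eta> \<mu> C w \<beta> $ l / \<tau>)) > 0"
    using pos by (intro sum_pos_UNIV mult_pos_pos) auto
  have vpos: "v $ i > 0" for i
    using W pos by (simp add: v_def bary_weights_def)
  have vsum: "(\<Sum>i\<in>UNIV. v $ i) = 1"
    using W by (simp add: v_def bary_weights_def sum_divide_distrib[symmetric])
  have Z: "(\<Sum>l\<in>UNIV. \<mu> k $ l * exp ((b $ l - C k $ i $ l) / \<eta>)) > 0" for k i b
    using pos by (intro sum_pos_UNIV mult_pos_pos) auto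
  have Ppos: "plan \<eta> (\<mu> k) (C k) b $ i $ j > 0" for k b i j
    using Z pos by (simp add: plan_def)
  have Psum: "(\<Sum>j\<in>UNIV. plan \<eta> (\<mu> k) (C k) b $ i $ j) = 1" for k b i
    using Z[of k b i] by (simp add: plan_def sum_divide_distrib[symmetric])
  have kept: "kept_mass \<rho> (plan \<eta> (\<mu> k) (C k) b) i \<ge> 0" for k b i
    unfolding kept_mass_def using Ppos[THEN less_imp_le] by (intro sum_nonneg) auto
  have Qnn: "Q k $ i $ j \<ge> 0" for k i j
    using Ppos[THEN less_imp_le] kept by (simp add: Q_def sparsify_def)
  have Qsum: "(\<Sum>j\<in>UNIV. Q k $ i $ j) = 1" for k i
  proof (cases "i = istar")
    case True then show ?thesis by (simp add: Q_def sparsify_def Psum)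
  next
    case False
    then show ?thesis using den[OF False, of k]
      by (simp add: Q_def sparsify_def sum_divide_distrib[symmetric] kept_mass_def)
  qed
  have Qstar: "Q k $ istar $ j > 0" for k j
    using Ppos by (simp add: Q_def sparsify_def)
  have Hnth: "(?H *v x) $ (k, j) =
      w k / \<tau> * (\<Sum>i\<in>UNIV. v $ i * Q k $ i $ j * (S x i - (\<Sum>l\<in>UNIV. v $ l * S x l)))
    + w k / \<eta> * (\<Sum>i\<in>UNIV. v $ i * Q k $ i $ j * (x $ (k, j) - y x k i))" for x k j
    unfolding S_def y_def v_def Q_def by (rule sparse_hessian_mult_nth)
  show ?thesis
  proof (intro set_eqI iffI; clarsimp)
    fix x k j l
    assume H0: "?H *v x = 0"
    define m where "m = (\<Sum>l\<in>UNIV. v $ l * S x l)"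
    define T where "T = (\<Sum>i\<in>UNIV. v $ i * (S x i - m)\<^sup>2)"
    define U where "U k = (\<Sum>i\<in>UNIV. v $ i * (\<Sum>j\<in>UNIV. Q k $ i $ j * (x $ (k, j) - y x k i)\<^sup>2))" for k
    have T: "T = (\<Sum>i\<in>UNIV. v $ i * S x i * (S x i - m))"
    proof -
      have "T = (\<Sum>i\<in>UNIV. v $ i * S x i * (S x i - m)) - m * (\<Sum>i\<in>UNIV. v $ i * (S x i - m))"
        unfolding T_def sum_distrib_left sum_subtractf[symmetric]
        by (intro sum.cong refl) (simp add: power2_eq_square algebra_simps)
      also have "(\<Sum>i\<in>UNIV. v $ i * (S x i - m)) = 0"
        by (simp add: right_diff_distrib sum_subtractf sum_distrib_right[symmetric] vsum m_def)
      finally show ?thesis by simp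
    qed
    have inner: "(\<Sum>j\<in>UNIV. Q k $ i $ j * (x $ (k, j) * (x $ (k, j) - y x k i)))
        = (\<Sum>j\<in>UNIV. Q k $ i $ j * (x $ (k, j) - y x k i)\<^sup>2)" for k i
    proof -
      have "(\<Sum>j\<in>UNIV. Q k $ i $ j * (x $ (k, j) - y x k i)\<^sup>2)
         = (\<Sum>j\<in>UNIV. Q k $ i $ j * (x $ (k, j) * (x $ (k, j) - y x k i)))
           - y x k i * (\<Sum>j\<in>UNIV. Q k $ i $ j * (x $ (k, j) - y x k i))"
        unfolding sum_distrib_left sum_subtractf[symmetric]
        by (intro sum.cong refl) (simp add: power2_eq_square algebra_simps)
      also have "(\<Sum>j\<in>UNIV. Q k $ i $ j * (x $ (k, j) - y x k i)) = 0"
        by (simp add: right_diff_distrib sum_subtractf sum_distrib_right[symmetric] Qsum)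
           (simp add: y_def)
      finally show ?thesis by simp
    qed
    have row: "(\<Sum>j\<in>UNIV. x $ (k, j) * (?H *v x) $ (k, j))
        = w k / \<tau> * (\<Sum>i\<in>UNIV. v $ i * y x k i * (S x i - m)) + w k / \<eta> * U k" for k
    proof -
      have "(\<Sum>j\<in>UNIV. x $ (k, j) * (?H *v x) $ (k, j))
        = w k / \<tau> * (\<Sum>j\<in>UNIV. \<Sum>i\<in>UNIV. v $ i * (S x i - m) * (Q k $ i $ j * x $ (k, j)))
        + w k / \<eta> * (\<Sum>j\<in>UNIV. \<Sum>i\<in>UNIV. v $ i * (Q k $ i $ j * (x $ (k, j) * (x $ (k, j) - y x k i))))"
        unfolding Hnth m_def[symmetric] sum_distrib_left sum.distrib[symmetric]
        by (intro sum.cong refl) (simp add: algebra_simps)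
      also have "(\<Sum>j\<in>UNIV. \<Sum>i\<in>UNIV. v $ i * (S x i - m) * (Q k $ i $ j * x $ (k, j)))
        = (\<Sum>i\<in>UNIV. v $ i * y x k i * (S x i - m))"
        by (subst sum.swap) (simp add: y_def sum_distrib_left sum_distrib_right mult_ac)
      also have "(\<Sum>j\<in>UNIV. \<Sum>i\<in>UNIV. v $ i * (Q k $ i $ j * (x $ (k, j) * (x $ (k, j) - y x k i)))) = U k"
        by (subst sum.swap) (simp add: sum_distrib_left[symmetric] inner U_def)
      finally show ?thesis .
    qed
    have "0 = (\<Sum>k\<in>UNIV. \<Sum>j\<in>UNIV. x $ (k, j) * (?H *v x) $ (k, j))"
      by (simp add: H0)
    also have "\<dots> = (\<Sum>k\<in>UNIV. w k / \<tau> * (\<Sum>i\<in>UNIV. v $ i * y x k i * (S x i - m)))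
        + (\<Sum>k\<in>UNIV. w k / \<eta> * U k)"
      by (simp only: row sum.distrib)
    also have "(\<Sum>k\<in>UNIV. w k / \<tau> * (\<Sum>i\<in>UNIV. v $ i * y x k i * (S x i - m))) = T / \<tau>"
    proof -
      have "(\<Sum>k\<in>UNIV. w k / \<tau> * (\<Sum>i\<in>UNIV. v $ i * y x k i * (S x i - m)))
         = (\<Sum>k\<in>UNIV. \<Sum>i\<in>UNIV. v $ i * (S x i - m) / \<tau> * (w k * y x k i))"
        by (simp add: sum_distrib_left mult_ac)
      also have "\<dots> = (\<Sum>i\<in>UNIV. \<Sum>k\<in>UNIV. v $ i * (S x i - m) / \<tau> * (w k * y x k i))"
        by (rule sum.swap)
      also have "\<dots> = (\<Sum>i\<in>UNIV. v $ i * (S x i - m) / \<tau> * S x i)"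
        by (simp add: S_def sum_distrib_left)
      also have "\<dots> = T / \<tau>"
        unfolding T sum_divide_distrib by (intro sum.cong refl) (simp add: mult_ac)
      finally show ?thesis .
    qed
    finally have eq: "T / \<tau> + (\<Sum>k\<in>UNIV. w k / \<eta> * U k) = 0" by simp
    have "T \<ge> 0" unfolding T_def using vpos[THEN less_imp_le] by (intro sum_nonneg) auto
    have Unn: "U k \<ge> 0" for k unfolding U_def using vpos[THEN less_imp_le] Qnn
      by (intro sum_nonneg mult_nonneg_nonneg) auto
    have nn: "w k / \<eta> * U k \<ge> 0" for k
      using Unn pos(1) pos(5)[THEN less_imp_le] by simp
    have "(\<Sum>k\<in>UNIV. w k / \<eta> * U k) = 0"
      using eq \<open>T \<ge> 0\<close> pos(2) sum_nonneg[of UNIV "\<lambda>k. w k / \<eta> * U k"] nn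
      by (smt (verit) divide_nonneg_pos)
    then have "w k / \<eta> * U k = 0" using nn by (simp add: sum_nonneg_eq_0_iff)
    then have "U k = 0" using pos(1) pos(5)[of k] by simp
    then have "v $ istar * (\<Sum>j\<in>UNIV. Q k $ istar $ j * (x $ (k, j) - y x k istar)\<^sup>2) = 0"
      unfolding U_def using vpos[THEN less_imp_le] Qnn
      by (subst (asm) sum_nonneg_eq_0_iff) (auto intro!: mult_nonneg_nonneg sum_nonneg)
    then have "(\<Sum>j\<in>UNIV. Q k $ istar $ j * (x $ (k, j) - y x k istar)\<^sup>2) = 0"
      using vpos[of istar] by simp
    then have "\<forall>j. Q k $ istar $ j * (x $ (k, j) - y x k istar)\<^sup>2 = 0"
      using Qnn by (subst (asm) sum_nonneg_eq_0_iff) auto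
    then have "x $ (k, j) = y x k istar" for j using Qstar[of k j] by (smt (verit) mult_eq_0_iff power2_eq_square)
    then show "x $ (k, j) = x $ (k, l)" by simp
  next
    fix x :: "real ^ ('k \<times> 'm)"
    assume c: "\<forall>k j l. x $ (k, j) = x $ (k, l)"
    have yx: "y x k i = x $ (k, j)" for k i j
    proof -
      have "y x k i = (\<Sum>l\<in>UNIV. Q k $ i $ l * x $ (k, j))"
        unfolding y_def using c by (intro sum.cong refl) metis
      then show ?thesis by (simp add: sum_distrib_right[symmetric] Qsum)
    qed
    have "S x i = S x l" for i l
      unfolding S_def using yx by (intro sum.cong refl) metis
    then have "(\<Sum>l\<in>UNIV. v $ l * S x l) = (\<Sum>l\<in>UNIV. v $ l * S x i)" for i
      by (intro sum.cong refl) metis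
    moreover have "(\<Sum>l\<in>UNIV. v $ l * S x i) = S x i" for i
      by (simp only: sum_distrib_right[symmetric] vsum mult_1)
    ultimately have Sm: "S x i - (\<Sum>l\<in>UNIV. v $ l * S x l) = 0" for i
      by (metis cancel_comm_monoid_add_class.diff_cancel)
    have xy: "x $ (k, j) - y x k i = 0" for k i j
      by (simp only: yx[of k i j] diff_self)
    have "(?H *v x) $ (k, j) = 0" for k j
      unfolding Hnth Sm xy by simp
    then show "?H *v x = 0"
      by (simp add: vec_eq_iff split_paired_all)
  qed
qed

lemma V_eq_orthogonal_comp_kernel:
  fixes \<mu> :: "'k::finite \<Rightarrow> real ^ 'm::finite" and C :: "'k \<Rightarrow> real ^ 'm ^ 'n::finite"
  assumes "\<eta> > 0" "\<tau> > 0" "\<And>k j. 0 < \<mu> k $ j" "\<And>i. 0 < \<pi> $ i" "\<And>k. 0 < w k"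
    and "\<And>k i. i \<noteq> istar \<Longrightarrow> kept_mass \<rho> (plan \<eta> (\<mu> k) (C k) (blk k \<beta>)) i \<noteq> 0"
  shows "V = orthogonal_comp {x. sparse_hessian \<eta> \<tau> \<mu> C w \<pi> \<rho> istar \<beta> *v x = 0}"
proof -
  have "(\<forall>k. (\<Sum>j\<in>UNIV. b $ (k, j)) = 0) \<longleftrightarrow>
      (\<forall>x. (\<forall>k j l. x $ (k, j) = x $ (k, l)) \<longrightarrow> x \<bullet> b = 0)" for b :: "real ^ ('k \<times> 'm)"
  proof (intro iffI allI impI)
    fix x :: "real ^ ('k \<times> 'm)"
    assume s: "\<forall>k. (\<Sum>j\<in>UNIV. b $ (k, j)) = 0" and c: "\<forall>k j l. x $ (k, j) = x $ (k, l)"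
    have "(\<Sum>j\<in>UNIV. x $ (k, j) * b $ (k, j)) = (\<Sum>j\<in>UNIV. x $ (k, undefined) * b $ (k, j))" for k
      using c by (intro sum.cong refl) metis
    then show "x \<bullet> b = 0" using s
      by (simp add: inner_vec_def sum_prod_UNIV sum_distrib_left[symmetric])
  next
    fix k0
    assume a: "\<forall>x. (\<forall>k j l. x $ (k, j) = x $ (k, l)) \<longrightarrow> x \<bullet> b = 0"
    define x :: "real ^ ('k \<times> 'm)" where "x = (\<chi> a. if fst a = k0 then 1 else 0)"
    have "x \<bullet> b = 0" using a by (simp add: x_def)
    moreover have "x \<bullet> b = (\<Sum>k\<in>UNIV. if k = k0 then (\<Sum>j\<in>UNIV. b $ (k, j)) else 0)"
      unfolding inner_vec_def sum_prod_UNIV by (intro sum.cong refl) (simp add: x_def)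
    ultimately show "(\<Sum>j\<in>UNIV. b $ (k0, j)) = 0" by simp
  qed
  then have "V = orthogonal_comp {x :: real ^ ('k \<times> 'm). \<forall>k j l. x $ (k, j) = x $ (k, l)}"
    by (simp add: V_def blk_def orthogonal_def orthogonal_comp_def)
  also have "{x. \<forall>k j l. x $ (k, j) = x $ (k, l)}
      = {x. sparse_hessian \<eta> \<tau> \<mu> C w \<pi> \<rho> istar \<beta> *v x = 0}"
    using assms by (intro kernel_sparse_hessian[symmetric]) auto
  finally show ?thesis .
qed

end

theory Submission
  imports Defs
begin

text \<open>
  Write \<open>e = \<beta> - \<beta>\<^sup>*\<close> for the error before a full step, \<open>g\<close> for the gradient at \<open>\<beta>\<close>, \<open>H\<close> for the
  sparsified Hessian at \<open>\<beta>\<close>, \<open>d\<close> for the regularized Newton direction, and \<open>z = e + d\<close> for the error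
  after the step. Adding \<open>(H + \<parallel>g\<parallel>I) e\<close> to the equation \<open>(H + \<parallel>g\<parallel>I) d = -g\<close> gives
  \<open>(H + \<parallel>g\<parallel>I) z = (H e - g) + \<parallel>g\<parallel>e\<close>. This holds at \<open>g = 0\<close> too, where \<open>d = 0\<close>, so a stationary
  iterate needs no separate treatment. Quadratic convergence follows from two estimates: the right-hand
  side is \<open>O(\<parallel>e\<parallel>\<^sup>2)\<close>, and \<open>H\<close> is bounded below by a positive constant on \<open>V\<close>, where \<open>z\<close> lies
  (lemma \<open>newton_step_quadratic\<close>).

  For the right-hand side, the exact Hessian and all its sparsifications are the values of one expression
  \<open>hess_apply v Q x\<close>, polynomial in the weights \<open>v\<close> and the plans \<open>Q\<close>. On probability vectors it is
  bounded by a multiple of \<open>\<parallel>x\<parallel>\<close> and Lipschitz in \<open>(v, Q)\<close> (\<open>hess_apply_bound\<close>,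
  \<open>hess_apply_Lipschitz\<close>). The gradient vanishes at \<open>\<beta>\<^sup>*\<close>: it always lies in \<open>V\<close>, and at a minimizer
  over \<open>V\<close> it is orthogonal to \<open>V\<close>. So the mean value theorem, applied to each component of the gradient
  on the segment from \<open>\<beta>\<^sup>*\<close> to \<open>\<beta>\<close>, writes that component of \<open>g\<close> as a component of
  \<open>hess_apply v Q e\<close> with \<open>v\<close> and \<open>Q\<close> taken at a point of the segment. Hence \<open>\<parallel>g\<parallel> = O(\<parallel>e\<parallel>)\<close>, so
  \<open>\<parallel>g\<parallel>e\<close> is quadratic. Moreover each component of \<open>H e - g\<close> compares two values of \<open>hess_apply\<close>
  applied to the same \<open>e\<close>, whose weights and plans differ by \<open>O(\<parallel>e\<parallel>)\<close>: weights and plans are softmax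
  functions, hence Lipschitz, and sparsification moves the plans by \<open>O(\<rho>) = O(\<parallel>g\<parallel>) = O(\<parallel>e\<parallel>)\<close>
  (\<open>sparsify_error\<close>). These bounds are global.

  Only the lower bound is local. The quadratic form of \<open>H\<close> is a nonnegative combination of variances, and
  the row of the largest weight is never sparsified. That weight is at least \<open>1/n\<close>, and the entries of that
  row stay away from \<open>0\<close> near \<open>\<beta>\<^sup>*\<close>; since block means vanish on \<open>V\<close>, the variances of this row alone
  dominate a multiple of \<open>\<parallel>x\<parallel>\<^sup>2\<close> (\<open>hess_apply_coercive\<close>, \<open>hess_coercive_near\<close>).
\<close>

section \<open>Softmax functions along a line\<close>

text \<open>
  The optimal plans and the barycenter weights are both softmax functions, and the potentials are
  log-sum-exp functions, so these two derivatives are the only calculus needed for all of them.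
\<close>

lemma
  fixes a :: "'d::finite \<Rightarrow> real" and \<theta> :: "'d \<Rightarrow> real \<Rightarrow> real"
  assumes a: "\<And>l. 0 < a l" and \<theta>: "\<And>l. (\<theta> l has_real_derivative t l) (at s)"
  defines "Z \<equiv> \<lambda>s. \<Sum>l\<in>UNIV. a l * exp (\<theta> l s)"
  defines "q \<equiv> \<lambda>l. a l * exp (\<theta> l s) / Z s"
  shows DERIV_log_sum_exp:
      "((\<lambda>s. ln (Z s)) has_real_derivative (\<Sum>l\<in>UNIV. q l * t l)) (at s)"
    and DERIV_softmax:
      "((\<lambda>s. a i * exp (\<theta> i s) / Z s) has_real_derivative q i * (t i - (\<Sum>l\<in>UNIV. q l * t l))) (at s)"
proof -
  have Z: "Z s > 0"
    unfolding Z_def using a by (intro sum_pos_UNIV) simp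
  have dE: "((\<lambda>s. a l * exp (\<theta> l s)) has_real_derivative a l * exp (\<theta> l s) * t l) (at s)" for l
    by (auto intro!: derivative_eq_intros \<theta>)
  have "(Z has_real_derivative (\<Sum>l\<in>UNIV. a l * exp (\<theta> l s) * t l)) (at s)"
    unfolding Z_def by (intro DERIV_sum dE)
  moreover have "(\<Sum>l\<in>UNIV. a l * exp (\<theta> l s) * t l) = Z s * (\<Sum>l\<in>UNIV. q l * t l)"
    using Z by (simp add: q_def sum_distrib_left)
  ultimately have dZ: "(Z has_real_derivative Z s * (\<Sum>l\<in>UNIV. q l * t l)) (at s)"
    by simp
  show "((\<lambda>s. ln (Z s)) has_real_derivative (\<Sum>l\<in>UNIV. q l * t l)) (at s)"
    using Z by (auto intro!: derivative_eq_intros dZ)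
  show "((\<lambda>s. a i * exp (\<theta> i s) / Z s) has_real_derivative q i * (t i - (\<Sum>l\<in>UNIV. q l * t l))) (at s)"
    by (rule DERIV_cong[OF DERIV_divide[OF dE dZ]])
       (use Z in \<open>simp_all add: q_def field_simps\<close>)
qed

section \<open>Estimates for probability vectors and finite sums\<close>

lemma prob_simplexD:
  assumes "p \<in> prob_simplex"
  shows "0 \<le> p $ i" and "(\<Sum>i\<in>UNIV. p $ i) = 1"
  using assms by (auto simp: prob_simplex_def)

lemma prob_simplex_le_1:
  fixes p :: "real ^ 'd::finite"
  assumes "p \<in> prob_simplex"
  shows "\<bar>p $ i\<bar> \<le> 1"
proof -
  have "p $ i \<le> (\<Sum>i\<in>UNIV. p $ i)"
    using assms by (intro member_le_sum) (auto simp: prob_simplex_def)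
  then show ?thesis using prob_simplexD[OF assms] by simp
qed

lemma abs_average_le:
  fixes p :: "real ^ 'd::finite"
  assumes "p \<in> prob_simplex" and "\<And>i. \<bar>f i\<bar> \<le> B"
  shows "\<bar>\<Sum>i\<in>UNIV. p $ i * f i\<bar> \<le> B"
proof -
  have "\<bar>\<Sum>i\<in>UNIV. p $ i * f i\<bar> \<le> (\<Sum>i\<in>UNIV. p $ i * B)"
    using assms by (intro order_trans[OF sum_abs] sum_mono)
      (auto simp: abs_mult prob_simplexD intro!: mult_left_mono)
  also have "\<dots> = B"
    using prob_simplexD(2)[OF assms(1)] by (simp add: sum_distrib_right[symmetric])
  finally show ?thesis .
qed

text \<open>
  Expanding the square leaves, besides the left-hand side, \<open>M f\<close> times the mean of \<open>f - M f\<close>, which is \<open>0\<close>.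
\<close>

lemma variance_eq:
  fixes p :: "real ^ 'd::finite"
  assumes "p \<in> prob_simplex"
  defines "M \<equiv> \<lambda>f. \<Sum>i\<in>UNIV. p $ i * f i"
  shows "(\<Sum>i\<in>UNIV. p $ i * (f i * (f i - M f))) = (\<Sum>i\<in>UNIV. p $ i * (f i - M f)\<^sup>2)"
proof -
  have "(\<Sum>i\<in>UNIV. p $ i * (f i - M f)\<^sup>2)
      = (\<Sum>i\<in>UNIV. p $ i * (f i * (f i - M f))) - M f * (\<Sum>i\<in>UNIV. p $ i * (f i - M f))"
    unfolding sum_distrib_left sum_subtractf[symmetric]
    by (intro sum.cong refl) (simp add: power2_eq_square algebra_simps)
  also have "(\<Sum>i\<in>UNIV. p $ i * (f i - M f)) = 0"
    using prob_simplexD(2)[OF assms(1)]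
    by (simp add: right_diff_distrib sum_subtractf sum_distrib_right[symmetric] M_def)
  finally show ?thesis by simp
qed

lemma abs_mult_diff_le:
  fixes a b :: real
  assumes "\<bar>a - a'\<bar> \<le> d" "\<bar>b\<bar> \<le> B" "\<bar>a'\<bar> \<le> A" "\<bar>b - b'\<bar> \<le> e"
  shows "\<bar>a * b - a' * b'\<bar> \<le> d * B + A * e"
proof -
  have "a * b - a' * b' = (a - a') * b + a' * (b - b')"
    by (simp add: algebra_simps)
  then have "\<bar>a * b - a' * b'\<bar> \<le> \<bar>a - a'\<bar> * \<bar>b\<bar> + \<bar>a'\<bar> * \<bar>b - b'\<bar>"
    by (metis abs_mult abs_triangle_ineq)
  also have "\<dots> \<le> d * B + A * e"
    using assms by (intro add_mono mult_mono) auto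
  finally show ?thesis .
qed

lemma abs_sum_diff_le:
  fixes f g :: "'d::finite \<Rightarrow> real"
  assumes "\<And>i. \<bar>f i - g i\<bar> \<le> d"
  shows "\<bar>(\<Sum>i\<in>UNIV. f i) - (\<Sum>i\<in>UNIV. g i)\<bar> \<le> real CARD('d) * d"
proof -
  have "\<bar>\<Sum>i\<in>UNIV. f i - g i\<bar> \<le> (\<Sum>i::'d\<in>UNIV. d)"
    using assms by (intro order_trans[OF sum_abs] sum_mono)
  then show ?thesis by (simp add: sum_subtractf)
qed

lemma norm_le_card_mult:
  fixes x :: "real ^ 'd::finite"
  assumes "\<And>a. \<bar>x $ a\<bar> \<le> B"
  shows "norm x \<le> real CARD('d) * B"
  using norm_le_l1_cart[of x] sum_mono[of UNIV "\<lambda>a. \<bar>x $ a\<bar>" "\<lambda>_. B"] assms by simp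

section \<open>The Hessian as a function of weights and plans\<close>

text \<open>
  The product of the Hessian with \<open>x\<close>, with weights and plans as free arguments. This makes the exact
  Hessian, its sparsifications, and the Hessians at intermediate points values of the same function.
\<close>

definition hess_apply :: "real \<Rightarrow> real \<Rightarrow> ('k \<Rightarrow> real) \<Rightarrow> real ^ 'n \<Rightarrow> ('k \<Rightarrow> real ^ 'm ^ 'n)
    \<Rightarrow> real ^ ('k::finite \<times> 'm::finite) \<Rightarrow> real ^ ('k \<times> 'm)" where
  "hess_apply \<eta> \<tau> w v Q x =
     (let y = (\<lambda>k i. \<Sum>j\<in>UNIV. Q k $ i $ j * x $ (k, j));
          S = (\<lambda>i. \<Sum>k\<in>UNIV. w k * y k i)
      in \<chi> a. case a of (k, j) \<Rightarrow> w k / \<tau> * (\<Sum>i\<in>UNIV. v $ i * Q k $ i $ j * (S i - (\<Sum>l\<in>UNIV. v $ l * S l)))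
                 + w k / \<eta> * (\<Sum>i\<in>UNIV. v $ i * Q k $ i $ j * (x $ (k, j) - y k i)))"

lemma sparse_hessian_mult_eq:
  "sparse_hessian \<eta> \<tau> \<mu> C w \<pi> \<rho> istar \<beta> *v x =
   hess_apply \<eta> \<tau> w (bary_weights \<eta> \<tau> \<mu> C w \<pi> \<beta>)
     (\<lambda>k. sparsify \<rho> istar (plan \<eta> (\<mu> k) (C k) (blk k \<beta>))) x"
  by (simp add: vec_eq_iff split_paired_all sparse_hessian_mult_nth hess_apply_def Let_def)

lemma abs_plan_average_le:
  fixes Q :: "'k::finite \<Rightarrow> real ^ 'm::finite ^ 'n::finite" and w :: "'k \<Rightarrow> real"
  assumes w: "\<And>k. 0 < w k" "(\<Sum>k\<in>UNIV. w k) = 1" and Q: "\<And>k i. Q k $ i \<in> prob_simplex"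
  shows "\<bar>\<Sum>j\<in>UNIV. Q k $ i $ j * x $ (k, j)\<bar> \<le> norm x"
    and "\<bar>\<Sum>k\<in>UNIV. w k * (\<Sum>j\<in>UNIV. Q k $ i $ j * x $ (k, j))\<bar> \<le> norm x"
proof -
  show y: "\<bar>\<Sum>j\<in>UNIV. Q k $ i $ j * x $ (k, j)\<bar> \<le> norm x" for k
    by (intro abs_average_le Q component_le_norm_cart)
  have "(\<chi> k. w k) \<in> prob_simplex"
    using w by (simp add: prob_simplex_def less_imp_le)
  from abs_average_le[OF this y]
  show "\<bar>\<Sum>k\<in>UNIV. w k * (\<Sum>j\<in>UNIV. Q k $ i $ j * x $ (k, j))\<bar> \<le> norm x"
    by simp
qed

lemma hess_apply_bound:
  fixes Q :: "'k::finite \<Rightarrow> real ^ 'm::finite ^ 'n::finite" and w :: "'k \<Rightarrow> real"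
  assumes pos: "\<eta> > 0" "\<tau> > 0" and w: "\<And>k. 0 < w k" "(\<Sum>k\<in>UNIV. w k) = 1"
    and v: "v \<in> prob_simplex" and Q: "\<And>k i. Q k $ i \<in> prob_simplex"
  shows "\<bar>hess_apply \<eta> \<tau> w v Q x $ a\<bar> \<le> (2 / \<tau> + 2 / \<eta>) * norm x"
proof -
  obtain k j where a: "a = (k, j)" by (cases a)
  define y where "y k i = (\<Sum>j\<in>UNIV. Q k $ i $ j * x $ (k, j))" for k i
  define S where "S i = (\<Sum>k\<in>UNIV. w k * y k i)" for i
  define m where "m = (\<Sum>l\<in>UNIV. v $ l * S l)"
  have y: "\<bar>y k i\<bar> \<le> norm x" and S: "\<bar>S i\<bar> \<le> norm x" for k i
    unfolding y_def S_def by (rule abs_plan_average_le[OF w Q])+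
  have m: "\<bar>m\<bar> \<le> norm x"
    unfolding m_def by (rule abs_average_le[OF v S])
  have *: "\<bar>\<Sum>i\<in>UNIV. v $ i * (Q k $ i $ j * f i)\<bar> \<le> 2 * norm x"
    if "\<And>i. \<bar>f i\<bar> \<le> 2 * norm x" for f
  proof (rule abs_average_le[OF v])
    fix i
    show "\<bar>Q k $ i $ j * f i\<bar> \<le> 2 * norm x"
      using mult_mono[OF prob_simplex_le_1[OF Q] that] by (simp add: abs_mult)
  qed
  have 1: "\<bar>\<Sum>i\<in>UNIV. v $ i * (Q k $ i $ j * (S i - m))\<bar> \<le> 2 * norm x"
  proof (rule *)
    show "\<bar>S i - m\<bar> \<le> 2 * norm x" for i using S[of i] m by linarith
  qed
  have 2: "\<bar>\<Sum>i\<in>UNIV. v $ i * (Q k $ i $ j * (x $ (k, j) - y k i))\<bar> \<le> 2 * norm x"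
  proof (rule *)
    show "\<bar>x $ (k, j) - y k i\<bar> \<le> 2 * norm x" for i
      using y[of k i] component_le_norm_cart[of x "(k, j)"] by linarith
  qed
  have wk: "0 < w k" "w k \<le> 1"
    using w member_le_sum[of k UNIV w] by (auto simp: less_imp_le)
  have **: "\<bar>w k / c * r\<bar> \<le> 2 / c * norm x" if "\<bar>r\<bar> \<le> 2 * norm x" "c > 0" for c r
  proof -
    have "w k * \<bar>r\<bar> \<le> 1 * (2 * norm x)"
      using that wk by (intro mult_mono) auto
    then show ?thesis using that wk by (simp add: abs_mult field_simps)
  qed
  have "hess_apply \<eta> \<tau> w v Q x $ a
      = w k / \<tau> * (\<Sum>i\<in>UNIV. v $ i * (Q k $ i $ j * (S i - m)))
      + w k / \<eta> * (\<Sum>i\<in>UNIV. v $ i * (Q k $ i $ j * (x $ (k, j) - y k i)))"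
    by (simp add: a hess_apply_def Let_def y_def S_def m_def mult.assoc)
  then show ?thesis
    using **[OF 1 pos(2)] **[OF 2 pos(1)] unfolding distrib_right by linarith
qed

text \<open>
  Every factor of a product in \<open>hess_apply\<close> is either an entry of \<open>v\<close> or \<open>Q\<close>, bounded by \<open>1\<close>, or a
  difference of entries or averages of \<open>x\<close>, bounded by \<open>2 * norm x\<close>; perturbing one factor at a time gives the constant.
\<close>

lemma hess_apply_Lipschitz:
  fixes Q Q' :: "'k::finite \<Rightarrow> real ^ 'm::finite ^ 'n::finite" and w :: "'k \<Rightarrow> real"
  assumes pos: "\<eta> > 0" "\<tau> > 0" and w: "\<And>k. 0 < w k" "(\<Sum>k\<in>UNIV. w k) = 1"
    and v: "v \<in> prob_simplex" "v' \<in> prob_simplex"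
    and Q: "\<And>k i. Q k $ i \<in> prob_simplex" "\<And>k i. Q' k $ i \<in> prob_simplex"
    and dv: "\<And>i. \<bar>v $ i - v' $ i\<bar> \<le> \<epsilon>" and dQ: "\<And>k i j. \<bar>Q k $ i $ j - Q' k $ i $ j\<bar> \<le> \<epsilon>"
  defines "m \<equiv> real CARD('m)" and "n \<equiv> real CARD('n)"
  shows "\<bar>hess_apply \<eta> \<tau> w v Q x $ a - hess_apply \<eta> \<tau> w v' Q' x $ a\<bar>
    \<le> (n * (4 + m + n * (1 + m)) / \<tau> + n * (4 + m) / \<eta>) * \<epsilon> * norm x"
proof -
  obtain k j where a: "a = (k, j)" by (cases a)
  have \<epsilon>: "\<epsilon> \<ge> 0" using dv[of undefined] by linarith
  define y where "y Q k i = (\<Sum>j\<in>UNIV. Q k $ i $ j * x $ (k, j))" for Q :: "'k \<Rightarrow> real ^ 'm ^ 'n" and k i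
  define S where "S Q i = (\<Sum>k\<in>UNIV. w k * y Q k i)" for Q i
  define M where "M v Q = (\<Sum>l\<in>UNIV. v $ l * S Q l)" for v Q
  have y: "\<bar>y Q k i\<bar> \<le> norm x" and S: "\<bar>S Q i\<bar> \<le> norm x" for k i
    unfolding y_def S_def by (rule abs_plan_average_le[OF w Q(1)])+
  have M: "\<bar>M v Q\<bar> \<le> norm x"
    unfolding M_def by (rule abs_average_le[OF v(1) S])
  have dy: "\<bar>y Q k i - y Q' k i\<bar> \<le> m * \<epsilon> * norm x" for k i
  proof -
    have "\<bar>y Q k i - y Q' k i\<bar> \<le> m * (\<epsilon> * norm x)"
      unfolding y_def m_def
    proof (rule abs_sum_diff_le)
      fix j
      show "\<bar>Q k $ i $ j * x $ (k, j) - Q' k $ i $ j * x $ (k, j)\<bar> \<le> \<epsilon> * norm x"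
        using mult_mono[OF dQ[of k i j] component_le_norm_cart[of x "(k, j)"]] \<epsilon>
        by (simp add: left_diff_distrib[symmetric] abs_mult)
    qed
    then show ?thesis by simp
  qed
  have dS: "\<bar>S Q i - S Q' i\<bar> \<le> m * \<epsilon> * norm x" for i
  proof -
    have "(\<chi> k. w k) \<in> prob_simplex"
      using w by (simp add: prob_simplex_def less_imp_le)
    from abs_average_le[OF this dy] show ?thesis
      by (simp add: S_def sum_subtractf right_diff_distrib)
  qed
  have dM: "\<bar>M v Q - M v' Q'\<bar> \<le> n * (\<epsilon> * norm x + 1 * (m * \<epsilon> * norm x))"
    unfolding M_def n_def
    by (intro abs_sum_diff_le abs_mult_diff_le dv S dS prob_simplex_le_1 v)
  have dvQ: "\<bar>v $ i * Q k $ i $ j - v' $ i * Q' k $ i $ j\<bar> \<le> \<epsilon> * 1 + 1 * \<epsilon>" for i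
    by (intro abs_mult_diff_le dv dQ prob_simplex_le_1 v Q)
  have vQ': "\<bar>v' $ i * Q' k $ i $ j\<bar> \<le> 1" for i
    using mult_mono[OF prob_simplex_le_1[OF v(2), of i] prob_simplex_le_1[OF Q(2), of k i j]]
    by (simp add: abs_mult)
  have 1: "\<bar>(\<Sum>i\<in>UNIV. v $ i * Q k $ i $ j * (S Q i - M v Q))
      - (\<Sum>i\<in>UNIV. v' $ i * Q' k $ i $ j * (S Q' i - M v' Q'))\<bar>
      \<le> n * ((\<epsilon> * 1 + 1 * \<epsilon>) * (2 * norm x)
            + 1 * (m * \<epsilon> * norm x + n * (\<epsilon> * norm x + 1 * (m * \<epsilon> * norm x))))"
    unfolding n_def
  proof (rule abs_sum_diff_le, rule abs_mult_diff_le[OF dvQ _ vQ'])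
    fix i
    show "\<bar>S Q i - M v Q\<bar> \<le> 2 * norm x" using S[of i] M by linarith
    show "\<bar>S Q i - M v Q - (S Q' i - M v' Q')\<bar>
        \<le> m * \<epsilon> * norm x + real CARD('n) * (\<epsilon> * norm x + 1 * (m * \<epsilon> * norm x))"
      using dS[of i] dM unfolding n_def by linarith
  qed
  have 2: "\<bar>(\<Sum>i\<in>UNIV. v $ i * Q k $ i $ j * (x $ (k, j) - y Q k i))
      - (\<Sum>i\<in>UNIV. v' $ i * Q' k $ i $ j * (x $ (k, j) - y Q' k i))\<bar>
      \<le> n * ((\<epsilon> * 1 + 1 * \<epsilon>) * (2 * norm x) + 1 * (m * \<epsilon> * norm x))"
    unfolding n_def
  proof (rule abs_sum_diff_le, rule abs_mult_diff_le[OF dvQ _ vQ'])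
    fix i
    show "\<bar>x $ (k, j) - y Q k i\<bar> \<le> 2 * norm x"
      using y[of k i] component_le_norm_cart[of x "(k, j)"] by linarith
    show "\<bar>x $ (k, j) - y Q k i - (x $ (k, j) - y Q' k i)\<bar> \<le> m * \<epsilon> * norm x"
      using dy[of k i] by linarith
  qed
  have wk: "0 < w k" "w k \<le> 1"
    using w member_le_sum[of k UNIV w] by (auto simp: less_imp_le)
  have **: "\<bar>w k / c * r - w k / c * r'\<bar> \<le> b / c" if "\<bar>r - r'\<bar> \<le> b" "c > 0" for c r r' b
  proof -
    have "w k * \<bar>r - r'\<bar> \<le> 1 * b"
      using that wk by (intro mult_mono) auto
    moreover have "w k / c * r - w k / c * r' = w k * (r - r') / c"
      by (simp add: diff_divide_distrib right_diff_distrib)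
    ultimately show ?thesis
      using that wk by (simp add: abs_mult divide_right_mono)
  qed
  have "hess_apply \<eta> \<tau> w v Q x $ a
      = w k / \<tau> * (\<Sum>i\<in>UNIV. v $ i * Q k $ i $ j * (S Q i - M v Q))
      + w k / \<eta> * (\<Sum>i\<in>UNIV. v $ i * Q k $ i $ j * (x $ (k, j) - y Q k i))" for v Q
    by (simp add: a hess_apply_def Let_def y_def S_def M_def)
  note split = this[of v Q] this[of v' Q']
  have "\<bar>hess_apply \<eta> \<tau> w v Q x $ a - hess_apply \<eta> \<tau> w v' Q' x $ a\<bar>
    \<le> n * ((\<epsilon> * 1 + 1 * \<epsilon>) * (2 * norm x)
            + 1 * (m * \<epsilon> * norm x + n * (\<epsilon> * norm x + 1 * (m * \<epsilon> * norm x)))) / \<tau>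
      + n * ((\<epsilon> * 1 + 1 * \<epsilon>) * (2 * norm x) + 1 * (m * \<epsilon> * norm x)) / \<eta>"
    using **[OF 1 pos(2)] **[OF 2 pos(1)] unfolding split by linarith
  also have "\<dots> = (n * (4 + m + n * (1 + m)) / \<tau> + n * (4 + m) / \<eta>) * \<epsilon> * norm x"
    using pos by (simp add: field_simps)
  finally show ?thesis .
qed

text \<open>
  Summed over \<open>j\<close>, each of the two terms contains the mean of a centered quantity: in the first the rows of
  \<open>Q\<close> sum to \<open>1\<close> and \<open>S\<close> is centered under \<open>v\<close>; in the second \<open>x\<close> is centered under each row of \<open>Q\<close>.
\<close>

lemma hess_apply_in_V:
  fixes Q :: "'k::finite \<Rightarrow> real ^ 'm::finite ^ 'n::finite"
  assumes v: "v \<in> prob_simplex" and Q: "\<And>k i. Q k $ i \<in> prob_simplex"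
  shows "hess_apply \<eta> \<tau> w v Q x \<in> V"
proof -
  define y where "y k i = (\<Sum>j\<in>UNIV. Q k $ i $ j * x $ (k, j))" for k i
  define S where "S i = (\<Sum>k\<in>UNIV. w k * y k i)" for i
  define m where "m = (\<Sum>l\<in>UNIV. v $ l * S l)"
  have *: "(\<Sum>j\<in>UNIV. \<Sum>i\<in>UNIV. v $ i * Q k $ i $ j * f i j)
      = (\<Sum>i\<in>UNIV. v $ i * (\<Sum>j\<in>UNIV. Q k $ i $ j * f i j))" for f k
    by (subst sum.swap) (simp add: sum_distrib_left mult.assoc)
  have "(\<Sum>j\<in>UNIV. \<Sum>i\<in>UNIV. v $ i * Q k $ i $ j * (S i - m)) = 0" for k
    using prob_simplexD(2)[OF v] prob_simplexD(2)[OF Q]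
    by (simp add: * sum_distrib_right[symmetric])
       (simp add: right_diff_distrib sum_subtractf sum_distrib_right[symmetric] m_def)
  moreover have "(\<Sum>j\<in>UNIV. \<Sum>i\<in>UNIV. v $ i * Q k $ i $ j * (x $ (k, j) - y k i)) = 0" for k
  proof -
    have "(\<Sum>j\<in>UNIV. Q k $ i $ j * (x $ (k, j) - y k i)) = 0" for i
      using prob_simplexD(2)[OF Q]
      by (simp add: right_diff_distrib sum_subtractf sum_distrib_right[symmetric] y_def)
    then show ?thesis by (simp add: *)
  qed
  ultimately show ?thesis
    by (simp add: V_def blk_def hess_apply_def Let_def sum.distrib
          sum_distrib_left[symmetric] sum_divide_distrib[symmetric] flip: y_def S_def m_def)
qed

text \<open>
  The first summand is the variance, under \<open>v\<close>, of the conditional means of \<open>x\<close> combined over the blocks;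
  the second collects the conditional variances of the blocks under the rows of the plans.
\<close>

lemma hess_apply_quadratic_form:
  fixes Q :: "'k::finite \<Rightarrow> real ^ 'm::finite ^ 'n::finite" and w :: "'k \<Rightarrow> real"
  assumes v: "v \<in> prob_simplex" and Q: "\<And>k i. Q k $ i \<in> prob_simplex"
  defines "y \<equiv> \<lambda>x k i. \<Sum>j\<in>UNIV. Q k $ i $ j * x $ (k, j)"
  defines "S \<equiv> \<lambda>x i. \<Sum>k\<in>UNIV. w k * y x k i"
  shows "x \<bullet> hess_apply \<eta> \<tau> w v Q x =
      (\<Sum>i\<in>UNIV. v $ i * (S x i - (\<Sum>l\<in>UNIV. v $ l * S x l))\<^sup>2) / \<tau>
    + (\<Sum>k\<in>UNIV. w k / \<eta> * (\<Sum>i\<in>UNIV. v $ i * (\<Sum>j\<in>UNIV. Q k $ i $ j * (x $ (k, j) - y x k i)\<^sup>2)))"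
proof -
  define m where "m = (\<Sum>l\<in>UNIV. v $ l * S x l)"
  have *: "(\<Sum>j\<in>UNIV. x $ (k, j) * (\<Sum>i\<in>UNIV. v $ i * Q k $ i $ j * f i j))
      = (\<Sum>i\<in>UNIV. v $ i * (\<Sum>j\<in>UNIV. Q k $ i $ j * (x $ (k, j) * f i j)))" for f k
    unfolding sum_distrib_left by (subst sum.swap) (simp add: mult_ac)
  have fst: "(\<Sum>j\<in>UNIV. x $ (k, j) * (\<Sum>i\<in>UNIV. v $ i * Q k $ i $ j * (S x i - m)))
      = (\<Sum>i\<in>UNIV. v $ i * (y x k i * (S x i - m)))" for k
    by (simp add: * mult.assoc[symmetric] sum_distrib_right[symmetric] y_def)
  have snd: "(\<Sum>j\<in>UNIV. x $ (k, j) * (\<Sum>i\<in>UNIV. v $ i * Q k $ i $ j * (x $ (k, j) - y x k i)))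
      = (\<Sum>i\<in>UNIV. v $ i * (\<Sum>j\<in>UNIV. Q k $ i $ j * (x $ (k, j) - y x k i)\<^sup>2))" for k
    unfolding * y_def variance_eq[OF Q, where f = "\<lambda>j. x $ (k, j)"] ..
  have "x \<bullet> hess_apply \<eta> \<tau> w v Q x
      = (\<Sum>k\<in>UNIV. \<Sum>j\<in>UNIV. x $ (k, j) *
          (w k / \<tau> * (\<Sum>i\<in>UNIV. v $ i * Q k $ i $ j * (S x i - m))
           + w k / \<eta> * (\<Sum>i\<in>UNIV. v $ i * Q k $ i $ j * (x $ (k, j) - y x k i))))"
    by (simp add: inner_vec_def sum_prod_UNIV hess_apply_def Let_def y_def S_def m_def)
  also have "\<dots> = (\<Sum>k\<in>UNIV. w k / \<tau> *
              (\<Sum>j\<in>UNIV. x $ (k, j) * (\<Sum>i\<in>UNIV. v $ i * Q k $ i $ j * (S x i - m))))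
        + (\<Sum>k\<in>UNIV. w k / \<eta> *
              (\<Sum>j\<in>UNIV. x $ (k, j) * (\<Sum>i\<in>UNIV. v $ i * Q k $ i $ j * (x $ (k, j) - y x k i))))"
    unfolding sum.distrib[symmetric] sum_distrib_left[where A = "UNIV :: 'm set"]
    by (intro sum.cong refl) (simp only: distrib_left mult.left_commute)
  also have "(\<Sum>k\<in>UNIV. w k / \<tau> *
              (\<Sum>j\<in>UNIV. x $ (k, j) * (\<Sum>i\<in>UNIV. v $ i * Q k $ i $ j * (S x i - m))))
      = (\<Sum>i\<in>UNIV. v $ i * (S x i * (S x i - m))) / \<tau>"
  proof -
    have "(\<Sum>k\<in>UNIV. w k / \<tau> * (\<Sum>i\<in>UNIV. v $ i * (y x k i * (S x i - m))))
        = (\<Sum>k\<in>UNIV. \<Sum>i\<in>UNIV. v $ i * (w k * y x k i * (S x i - m)) / \<tau>)"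
      by (simp add: sum_distrib_left mult_ac)
    also have "\<dots> = (\<Sum>i\<in>UNIV. \<Sum>k\<in>UNIV. v $ i * (w k * y x k i * (S x i - m)) / \<tau>)"
      by (rule sum.swap)
    also have "\<dots> = (\<Sum>i\<in>UNIV. v $ i * (S x i * (S x i - m))) / \<tau>"
      by (simp add: S_def sum_distrib_left sum_distrib_right sum_divide_distrib)
    finally show ?thesis unfolding fst .
  qed
  also have "(\<Sum>i\<in>UNIV. v $ i * (S x i * (S x i - m))) = (\<Sum>i\<in>UNIV. v $ i * (S x i - m)\<^sup>2)"
    unfolding m_def by (rule variance_eq[OF v])
  finally show ?thesis
    unfolding snd m_def .
qed

lemma hess_apply_nonneg:
  fixes Q :: "'k::finite \<Rightarrow> real ^ 'm::finite ^ 'n::finite"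
  assumes pos: "\<eta> > 0" "\<tau> > 0"
    and v: "v \<in> prob_simplex" and Q: "\<And>k i. Q k $ i \<in> prob_simplex" and w: "\<And>k. 0 \<le> w k"
  shows "0 \<le> x \<bullet> hess_apply \<eta> \<tau> w v Q x"
  unfolding hess_apply_quadratic_form[OF v Q]
  using pos w prob_simplexD(1)[OF v] prob_simplexD(1)[OF Q]
  by (intro add_nonneg_nonneg divide_nonneg_pos sum_nonneg mult_nonneg_nonneg) auto

text \<open>
  Only the conditional variances of row \<open>i0\<close> are kept. For \<open>x \<in> V\<close> each block has zero sum, so moving its
  center from \<open>0\<close> to any other point can only increase its sum of squares; hence the unknown row mean drops out.
\<close>

lemma hess_apply_coercive:
  fixes Q :: "'k::finite \<Rightarrow> real ^ 'm::finite ^ 'n::finite"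
  assumes pos: "\<eta> > 0" "\<tau> > 0"
    and v: "v \<in> prob_simplex" and Q: "\<And>k i. Q k $ i \<in> prob_simplex"
    and w: "\<And>k. w0 \<le> w k" and vi: "v0 \<le> v $ i0" and Qi: "\<And>k j. q0 \<le> Q k $ i0 $ j"
    and nn: "0 \<le> w0" "0 \<le> v0" "0 \<le> q0" and x: "x \<in> V"
  shows "w0 * v0 * q0 / \<eta> * (norm x)\<^sup>2 \<le> x \<bullet> hess_apply \<eta> \<tau> w v Q x"
proof -
  define y where "y k i = (\<Sum>j\<in>UNIV. Q k $ i $ j * x $ (k, j))" for k i
  define S where "S i = (\<Sum>k\<in>UNIV. w k * y k i)" for i
  define U where "U k i = (\<Sum>j\<in>UNIV. Q k $ i $ j * (x $ (k, j) - y k i)\<^sup>2)" for k i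
  have vn: "0 \<le> v $ i" and Qn: "0 \<le> Q k $ i $ j" for k i j
    using prob_simplexD(1) v Q by auto
  have U: "0 \<le> U k i" for k i
    unfolding U_def using Qn by (intro sum_nonneg) simp
  have blk: "v0 * (q0 * (\<Sum>j\<in>UNIV. (x $ (k, j))\<^sup>2)) \<le> (\<Sum>i\<in>UNIV. v $ i * U k i)" for k
  proof -
    \<comment> \<open>the added square is the cost of moving the center from 0 to the row mean; the cross term
      vanishes because the block sums to 0\<close>
    have "(\<Sum>j\<in>UNIV. (x $ (k, j))\<^sup>2) \<le> (\<Sum>j\<in>UNIV. (x $ (k, j))\<^sup>2) + real CARD('m) * (y k i0)\<^sup>2"
      by simp
    also have "\<dots> = (\<Sum>j\<in>UNIV. (x $ (k, j))\<^sup>2) - 2 * y k i0 * (\<Sum>j\<in>UNIV. x $ (k, j))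
        + (\<Sum>j::'m\<in>UNIV. (y k i0)\<^sup>2)"
      using x by (simp add: V_def blk_def)
    also have "\<dots> = (\<Sum>j\<in>UNIV. (x $ (k, j) - y k i0)\<^sup>2)"
      unfolding sum_distrib_left sum_subtractf[symmetric] sum.distrib[symmetric]
      by (intro sum.cong refl) (simp add: power2_eq_square algebra_simps)
    finally have "q0 * (\<Sum>j\<in>UNIV. (x $ (k, j))\<^sup>2) \<le> (\<Sum>j\<in>UNIV. q0 * (x $ (k, j) - y k i0)\<^sup>2)"
      unfolding sum_distrib_left[symmetric] using nn by (intro mult_left_mono)
    also have "\<dots> \<le> U k i0"
      unfolding U_def using Qi by (intro sum_mono mult_right_mono) auto
    finally have "v0 * (q0 * (\<Sum>j\<in>UNIV. (x $ (k, j))\<^sup>2)) \<le> v $ i0 * U k i0"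
      using vi nn by (intro mult_mono) (auto intro!: sum_nonneg mult_nonneg_nonneg)
    also have "\<dots> \<le> (\<Sum>i\<in>UNIV. v $ i * U k i)"
      using vn U by (intro member_le_sum) auto
    finally show ?thesis .
  qed
  have "(norm x)\<^sup>2 = (\<Sum>k\<in>UNIV. \<Sum>j\<in>UNIV. (x $ (k, j))\<^sup>2)"
    unfolding power2_norm_eq_inner inner_vec_def sum_prod_UNIV by (simp add: power2_eq_square)
  then have "w0 * v0 * q0 / \<eta> * (norm x)\<^sup>2
      = (\<Sum>k\<in>UNIV. w0 / \<eta> * (v0 * (q0 * (\<Sum>j\<in>UNIV. (x $ (k, j))\<^sup>2))))"
    by (simp add: sum_distrib_left mult.assoc)
  also have "\<dots> \<le> (\<Sum>k\<in>UNIV. w k / \<eta> * (\<Sum>i\<in>UNIV. v $ i * U k i))"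
  proof (intro sum_mono mult_mono blk)
    fix k
    show "w0 / \<eta> \<le> w k / \<eta>" and "0 \<le> w k / \<eta>"
      using pos nn w[of k] by (simp_all add: divide_right_mono)
    show "0 \<le> v0 * (q0 * (\<Sum>j\<in>UNIV. (x $ (k, j))\<^sup>2))"
      using nn by (simp add: sum_nonneg)
  qed
  also have "\<dots> \<le> (\<Sum>i\<in>UNIV. v $ i * (S i - (\<Sum>l\<in>UNIV. v $ l * S l))\<^sup>2) / \<tau>
      + (\<Sum>k\<in>UNIV. w k / \<eta> * (\<Sum>i\<in>UNIV. v $ i * U k i))"
    using pos vn by (simp add: sum_nonneg)
  also have "\<dots> = x \<bullet> hess_apply \<eta> \<tau> w v Q x"
    unfolding hess_apply_quadratic_form[OF v Q] U_def S_def y_def ..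
  finally show ?thesis .
qed

section \<open>The sparsification error\<close>

lemma sparsify_in_prob_simplex:
  fixes P :: "real ^ 'm::finite ^ 'n::finite"
  assumes P: "P $ i \<in> prob_simplex" and "i \<noteq> istar \<Longrightarrow> kept_mass \<rho> P i \<noteq> 0"
  shows "sparsify \<rho> istar P $ i \<in> prob_simplex"
proof (cases "i = istar")
  case True
  then show ?thesis using P by (simp add: sparsify_def prob_simplex_def)
next
  case False
  have "0 \<le> kept_mass \<rho> P i"
    unfolding kept_mass_def using prob_simplexD[OF P] by (intro sum_nonneg) simp
  then show ?thesis using False assms(2) prob_simplexD[OF P]
    by (auto simp: sparsify_def prob_simplex_def sum_divide_distrib[symmetric] kept_mass_def)
qed

text \<open>
  A dropped entry is smaller than \<open>\<rho>\<close>, so at most \<open>m\<rho>\<close> of the mass of a row is lost. A kept entry grows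
  by its share of the kept mass times the lost mass, so by no more than \<open>m\<rho>\<close>, however
  small the kept mass is.
\<close>

lemma sparsify_error:
  fixes P :: "real ^ 'm::finite ^ 'n::finite"
  assumes P: "P $ i \<in> prob_simplex" and kept: "i \<noteq> istar \<Longrightarrow> kept_mass \<rho> P i \<noteq> 0" and \<rho>: "0 \<le> \<rho>"
  shows "\<bar>sparsify \<rho> istar P $ i $ j - P $ i $ j\<bar> \<le> real CARD('m) * \<rho>"
proof (cases "i = istar")
  case True
  then show ?thesis using \<rho> by (simp add: sparsify_def)
next
  case False
  let ?K = "kept_mass \<rho> P i"
  have nn: "0 \<le> P $ i $ l" for l using prob_simplexD[OF P] by simp
  have K: "0 < ?K" using kept[OF False] nn
    by (simp add: kept_mass_def order_less_le sum_nonneg)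
  have "1 - ?K = (\<Sum>l\<in>UNIV. P $ i $ l - P $ i $ l * of_bool (\<rho> \<le> P $ i $ l))"
    using prob_simplexD(2)[OF P] by (simp add: kept_mass_def sum_subtractf)
  also have "\<dots> \<le> (\<Sum>l::'m\<in>UNIV. \<rho>)"
    using \<rho> by (intro sum_mono) (auto simp: of_bool_def)
  finally have lost: "1 - ?K \<le> real CARD('m) * \<rho>" by simp
  have K1: "?K \<le> 1"
    unfolding prob_simplexD(2)[OF P, symmetric] kept_mass_def using nn
    by (intro sum_mono) (auto simp: of_bool_def)
  show ?thesis
  proof (cases "\<rho> \<le> P $ i $ j")
    case True
    have "P $ i $ j * of_bool (\<rho> \<le> P $ i $ j) \<le> ?K"
      unfolding kept_mass_def using nn by (intro member_le_sum) auto
    then have PK: "P $ i $ j / ?K \<le> 1" using True K by simp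
    have "sparsify \<rho> istar P $ i $ j - P $ i $ j = P $ i $ j / ?K * (1 - ?K)"
      using False True K by (simp add: sparsify_def field_simps)
    then have "\<bar>sparsify \<rho> istar P $ i $ j - P $ i $ j\<bar> = P $ i $ j / ?K * (1 - ?K)"
      using K K1 nn by simp
    also have "\<dots> \<le> 1 * (1 - ?K)"
      using PK K1 by (intro mult_right_mono) auto
    finally show ?thesis using lost by simp
  next
    case small: False
    have "1 * \<rho> \<le> real CARD('m) * \<rho>"
      using \<rho> by (intro mult_right_mono) (auto simp: Suc_le_eq)
    with small have "P $ i $ j \<le> real CARD('m) * \<rho>" by linarith
    with False small nn[of j] show ?thesis by (simp add: sparsify_def)
  qed
qed

section \<open>The gradient map\<close>

locale wasserstein_barycenter =
  fixes \<eta> \<tau> :: real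
    and \<mu> :: "'k::finite \<Rightarrow> real ^ 'm::finite"
    and C :: "'k \<Rightarrow> real ^ 'm ^ 'n::finite"
    and w :: "'k \<Rightarrow> real"
    and \<pi> :: "real ^ 'n"
  assumes \<eta>_pos: "0 < \<eta>" and \<tau>_pos: "0 < \<tau>"
    and \<mu>_simplex: "\<And>k. \<mu> k \<in> prob_simplex" and \<mu>_pos: "\<And>k j. 0 < \<mu> k $ j"
    and w_pos: "\<And>k. 0 < w k" and w_sum: "(\<Sum>k\<in>UNIV. w k) = 1"
    and \<pi>_pos: "\<And>i. 0 < \<pi> $ i"
begin

abbreviation loss :: "real ^ ('k \<times> 'm) \<Rightarrow> real" where
  "loss \<equiv> dual_loss \<eta> \<tau> \<mu> C w \<pi>"

abbreviation grad :: "real ^ ('k \<times> 'm) \<Rightarrow> real ^ ('k \<times> 'm)" where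
  "grad \<equiv> gradient loss"

abbreviation weights :: "real ^ ('k \<times> 'm) \<Rightarrow> real ^ 'n" where
  "weights \<equiv> bary_weights \<eta> \<tau> \<mu> C w \<pi>"

abbreviation plans :: "real ^ ('k \<times> 'm) \<Rightarrow> 'k \<Rightarrow> real ^ 'm ^ 'n" where
  "plans b k \<equiv> plan \<eta> (\<mu> k) (C k) (blk k b)"

lemma GDERIV_loss: "GDERIV loss b :> grad b"
proof -
  note G = GDERIV_dual_loss[OF \<eta>_pos \<tau>_pos \<mu>_pos \<pi>_pos,
      where C = C and w = w and \<beta> = b]
  show ?thesis
    unfolding gradient_eqI[OF G] by (rule G)
qed

lemma grad_nth: "grad b $ (k, j) = w k * ((\<Sum>i\<in>UNIV. weights b $ i * plans b k $ i $ j) - \<mu> k $ j)"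
  unfolding gradient_eqI[OF GDERIV_dual_loss[OF \<eta>_pos \<tau>_pos \<mu>_pos \<pi>_pos]]
  by (simp add: matrix_vector_mult_def transpose_def mult_ac)

lemma weights_simplex: "weights b \<in> prob_simplex"
proof -
  have "0 < (\<Sum>l\<in>UNIV. \<pi> $ l * exp (- Phi \<eta> \<mu> C w b $ l / \<tau>))"
    using \<pi>_pos by (intro sum_pos_UNIV) simp
  then show ?thesis using \<pi>_pos
    by (simp add: prob_simplex_def bary_weights_def sum_divide_distrib[symmetric] less_imp_le)
qed

lemma plans_pos: "0 < plans b k $ i $ j"
  and plans_simplex: "plans b k $ i \<in> prob_simplex"
proof -
  have "0 < (\<Sum>l\<in>UNIV. \<mu> k $ l * exp ((blk k b $ l - C k $ i $ l) / \<eta>))"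
    using \<mu>_pos by (intro sum_pos_UNIV) simp
  then show "0 < plans b k $ i $ j" and "plans b k $ i \<in> prob_simplex" using \<mu>_pos
    by (simp_all add: prob_simplex_def plan_def sum_divide_distrib[symmetric] less_imp_le)
qed

text \<open>
  The second marginal of a plan and \<open>\<mu> k\<close> have the same total mass.
\<close>

lemma grad_in_V: "grad b \<in> V"
proof -
  have "(\<Sum>j\<in>UNIV. \<Sum>i\<in>UNIV. weights b $ i * plans b k $ i $ j) = 1" for k
    using prob_simplexD(2)[OF weights_simplex] prob_simplexD(2)[OF plans_simplex]
    by (subst sum.swap) (simp add: sum_distrib_left[symmetric])
  then show ?thesis
    using prob_simplexD(2)[OF \<mu>_simplex]
    by (simp add: V_def blk_def grad_nth sum_distrib_left[symmetric] sum_subtractf)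
qed

text \<open>
  Since the gradient lies in \<open>V\<close>, the minimizer may be moved along its own gradient without leaving \<open>V\<close>;
  the derivative in that direction is \<open>\<parallel>grad b\<parallel>\<^sup>2\<close>.
\<close>

lemma grad_eq_0_at_minimizer:
  assumes "is_arg_min loss (\<lambda>x. x \<in> V) b"
  shows "grad b = 0"
proof -
  let ?g = "grad b"
  have b: "b \<in> V" and min: "\<And>x. x \<in> V \<Longrightarrow> loss b \<le> loss x"
    using assms by (auto simp: is_arg_min_def not_less)
  have "((\<lambda>s. b + s *\<^sub>R ?g) has_derivative (\<lambda>s. s *\<^sub>R ?g)) (at 0)"
    by (auto intro!: derivative_eq_intros)
  moreover have "(loss has_derivative (\<lambda>x. x \<bullet> ?g)) (at (b + 0 *\<^sub>R ?g))"
    using GDERIV_loss[of b] by (simp add: gderiv_def)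
  ultimately have "((\<lambda>s. loss (b + s *\<^sub>R ?g)) has_derivative (\<lambda>s. (s *\<^sub>R ?g) \<bullet> ?g)) (at 0)"
    by (rule has_derivative_compose)
  then have "DERIV (\<lambda>s. loss (b + s *\<^sub>R ?g)) 0 :> ?g \<bullet> ?g"
    unfolding has_field_derivative_def by (rule has_derivative_eq_rhs) (simp add: fun_eq_iff)
  moreover have "loss (b + 0 *\<^sub>R ?g) \<le> loss (b + s *\<^sub>R ?g)" for s
    using b grad_in_V[of b]
    by (simp add: min V_def blk_def sum.distrib sum_distrib_left[symmetric])
  ultimately have "?g \<bullet> ?g = 0"
    by (intro DERIV_local_min[where d = 1]) auto
  then show ?thesis by simp
qed

lemma rescale_centered:
  fixes q t :: "'d::finite \<Rightarrow> real"
  shows "a * (x / c - (\<Sum>l\<in>UNIV. q l * (t l / c))) = a * (x - (\<Sum>l\<in>UNIV. q l * t l)) / c"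
proof -
  have "(\<Sum>l\<in>UNIV. q l * (t l / c)) = (\<Sum>l\<in>UNIV. q l * t l / c)"
    by (intro sum.cong refl) simp
  also have "\<dots> = (\<Sum>l\<in>UNIV. q l * t l) / c"
    by (rule sum_divide_distrib[symmetric])
  finally show ?thesis
    by (metis diff_divide_distrib times_divide_eq_right)
qed

context
  fixes b h :: "real ^ ('k \<times> 'm)"
begin

lemma DERIV_logit:
  "((\<lambda>s. ((b + s *\<^sub>R h) $ a - r) / \<eta>) has_real_derivative h $ a / \<eta>) (at s)"
proof -
  have "((\<lambda>s. (b $ a + s * h $ a - r) / \<eta>) has_real_derivative (0 + 1 * h $ a - 0) / \<eta>) (at s)"
    by (intro DERIV_cdivide DERIV_diff DERIV_add DERIV_const DERIV_cmult_right DERIV_ident)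
  then show ?thesis by simp
qed

lemma DERIV_plans:
  "((\<lambda>s. plans (b + s *\<^sub>R h) k $ i $ j) has_real_derivative
     plans (b + s *\<^sub>R h) k $ i $ j
       * (h $ (k, j) - (\<Sum>l\<in>UNIV. plans (b + s *\<^sub>R h) k $ i $ l * h $ (k, l))) / \<eta>) (at s)"
proof -
  note DERIV_softmax[where a = "\<lambda>l. \<mu> k $ l" and i = j
      and \<theta> = "\<lambda>l s. ((b + s *\<^sub>R h) $ (k, l) - C k $ i $ l) / \<eta>", OF \<mu>_pos DERIV_logit]
  then
  show ?thesis
    unfolding plan_def blk_def vec_lambda_beta by (rule DERIV_cong) (rule rescale_centered)
qed

lemma DERIV_Phi:
  "((\<lambda>s. Phi \<eta> \<mu> C w (b + s *\<^sub>R h) $ i) has_real_derivative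
     - (\<Sum>k\<in>UNIV. w k * (\<Sum>l\<in>UNIV. plans (b + s *\<^sub>R h) k $ i $ l * h $ (k, l)))) (at s)"
proof -
  note DERIV_log_sum_exp[where a = "\<lambda>l. \<mu> k $ l"
      and \<theta> = "\<lambda>l s. ((b + s *\<^sub>R h) $ (k, l) - C k $ i $ l) / \<eta>" for k, OF \<mu>_pos DERIV_logit]
  then have "((\<lambda>s. alpha \<eta> (\<mu> k) (C k) (blk k (b + s *\<^sub>R h)) $ i) has_real_derivative
      - \<eta> * (\<Sum>l\<in>UNIV. plans (b + s *\<^sub>R h) k $ i $ l * (h $ (k, l) / \<eta>))) (at s)" for k
    unfolding alpha_def plan_def blk_def vec_lambda_beta by (rule DERIV_cmult)
  then have "((\<lambda>s. \<Sum>k\<in>UNIV. w k * alpha \<eta> (\<mu> k) (C k) (blk k (b + s *\<^sub>R h)) $ i) has_real_derivative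
      (\<Sum>k\<in>UNIV. w k * (- \<eta> * (\<Sum>l\<in>UNIV. plans (b + s *\<^sub>R h) k $ i $ l * (h $ (k, l) / \<eta>))))) (at s)"
    by (intro DERIV_sum DERIV_cmult)
  moreover have "- \<eta> * (\<Sum>l\<in>UNIV. plans (b + s *\<^sub>R h) k $ i $ l * (h $ (k, l) / \<eta>))
      = - (\<Sum>l\<in>UNIV. plans (b + s *\<^sub>R h) k $ i $ l * h $ (k, l))" for k
    using \<eta>_pos by (simp add: sum_divide_distrib[symmetric])
  ultimately show ?thesis
    by (simp add: Phi_def sum_negf)
qed

lemma DERIV_weights:
  fixes s
  defines "S \<equiv> \<lambda>i. \<Sum>k\<in>UNIV. w k * (\<Sum>j\<in>UNIV. plans (b + s *\<^sub>R h) k $ i $ j * h $ (k, j))"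
  shows "((\<lambda>s. weights (b + s *\<^sub>R h) $ i) has_real_derivative
     weights (b + s *\<^sub>R h) $ i * (S i - (\<Sum>l\<in>UNIV. weights (b + s *\<^sub>R h) $ l * S l)) / \<tau>) (at s)"
proof -
  have "((\<lambda>s. - Phi \<eta> \<mu> C w (b + s *\<^sub>R h) $ l / \<tau>) has_real_derivative S l / \<tau>) (at s)" for l
    using DERIV_cdivide[OF DERIV_minus[OF DERIV_Phi]] unfolding S_def minus_minus .
  from DERIV_softmax[where a = "\<lambda>l. \<pi> $ l" and i = i
      and \<theta> = "\<lambda>l s. - Phi \<eta> \<mu> C w (b + s *\<^sub>R h) $ l / \<tau>", OF \<pi>_pos this]
  show ?thesis
    unfolding bary_weights_def vec_lambda_beta by (rule DERIV_cong) (rule rescale_centered)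
qed

text \<open>
  Differentiating the weights produces the \<open>1/\<tau>\<close> term of \<open>hess_apply\<close>, and differentiating the plans the
  \<open>1/\<eta>\<close> term.
\<close>

lemma DERIV_grad:
  "((\<lambda>s. grad (b + s *\<^sub>R h) $ a) has_real_derivative
     hess_apply \<eta> \<tau> w (weights (b + s *\<^sub>R h)) (plans (b + s *\<^sub>R h)) h $ a) (at s)"
proof -
  obtain k j where a: "a = (k, j)" by (cases a)
  let ?v = "weights (b + s *\<^sub>R h)" and ?P = "plans (b + s *\<^sub>R h)"
  define y where "y k i = (\<Sum>j\<in>UNIV. ?P k $ i $ j * h $ (k, j))" for k i
  define S where "S i = (\<Sum>k\<in>UNIV. w k * y k i)" for i
  define m where "m = (\<Sum>l\<in>UNIV. ?v $ l * S l)"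
  have "((\<lambda>s. w k * ((\<Sum>i\<in>UNIV. weights (b + s *\<^sub>R h) $ i * plans (b + s *\<^sub>R h) k $ i $ j) - \<mu> k $ j))
     has_real_derivative w k * ((\<Sum>i\<in>UNIV. ?v $ i * (S i - m) / \<tau> * ?P k $ i $ j
       + ?P k $ i $ j * (h $ (k, j) - y k i) / \<eta> * ?v $ i) - 0)) (at s)"
    unfolding m_def S_def y_def
    by (intro DERIV_cmult DERIV_diff DERIV_const DERIV_sum DERIV_mult DERIV_weights DERIV_plans)
  moreover have "(\<Sum>i\<in>UNIV. ?v $ i * (S i - m) / \<tau> * ?P k $ i $ j
       + ?P k $ i $ j * (h $ (k, j) - y k i) / \<eta> * ?v $ i)
      = (\<Sum>i\<in>UNIV. ?v $ i * ?P k $ i $ j * (S i - m)) / \<tau>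
        + (\<Sum>i\<in>UNIV. ?v $ i * ?P k $ i $ j * (h $ (k, j) - y k i)) / \<eta>"
    unfolding sum_divide_distrib sum.distrib[symmetric]
    by (intro sum.cong refl) (simp add: mult_ac)
  moreover have "hess_apply \<eta> \<tau> w ?v ?P h $ a
      = w k * ((\<Sum>i\<in>UNIV. ?v $ i * ?P k $ i $ j * (S i - m)) / \<tau>
        + (\<Sum>i\<in>UNIV. ?v $ i * ?P k $ i $ j * (h $ (k, j) - y k i)) / \<eta>)"
    unfolding a hess_apply_def Let_def y_def S_def m_def by (simp add: distrib_left)
  ultimately show ?thesis
    unfolding a grad_nth by simp
qed

end

lemma plans_Lipschitz: "\<bar>plans b' k $ i $ j - plans b k $ i $ j\<bar> \<le> 2 / \<eta> * norm (b' - b)"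
proof -
  define h where "h = b' - b"
  obtain s where "plans (b + 1 *\<^sub>R h) k $ i $ j - plans (b + 0 *\<^sub>R h) k $ i $ j
      = (1 - 0) * (plans (b + s *\<^sub>R h) k $ i $ j
       * (h $ (k, j) - (\<Sum>l\<in>UNIV. plans (b + s *\<^sub>R h) k $ i $ l * h $ (k, l))) / \<eta>)"
    using MVT2[OF zero_less_one DERIV_plans[where b = b and h = h and k = k and i = i and j = j]] by blast
  moreover have "\<bar>plans (b + s *\<^sub>R h) k $ i $ j
       * (h $ (k, j) - (\<Sum>l\<in>UNIV. plans (b + s *\<^sub>R h) k $ i $ l * h $ (k, l)))\<bar> \<le> 1 * (2 * norm h)"
    unfolding abs_mult
  proof (intro mult_mono prob_simplex_le_1 plans_simplex)
    show "\<bar>h $ (k, j) - (\<Sum>l\<in>UNIV. plans (b + s *\<^sub>R h) k $ i $ l * h $ (k, l))\<bar> \<le> 2 * norm h"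
    proof -
      have "\<bar>\<Sum>l\<in>UNIV. plans (b + s *\<^sub>R h) k $ i $ l * h $ (k, l)\<bar> \<le> norm h"
        by (rule abs_plan_average_le(1)[OF w_pos w_sum plans_simplex])
      then show ?thesis using component_le_norm_cart[of h "(k, j)"] by linarith
    qed
  qed auto
  ultimately show ?thesis
    using \<eta>_pos by (simp add: h_def divide_right_mono)
qed

lemma weights_Lipschitz: "\<bar>weights b' $ i - weights b $ i\<bar> \<le> 2 / \<tau> * norm (b' - b)"
proof -
  define h where "h = b' - b"
  define S where "S = (\<lambda>s i. \<Sum>k\<in>UNIV. w k * (\<Sum>j\<in>UNIV. plans (b + s *\<^sub>R h) k $ i $ j * h $ (k, j)))"
  obtain s where "weights (b + 1 *\<^sub>R h) $ i - weights (b + 0 *\<^sub>R h) $ i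
      = (1 - 0) * (weights (b + s *\<^sub>R h) $ i * (S s i - (\<Sum>l\<in>UNIV. weights (b + s *\<^sub>R h) $ l * S s l)) / \<tau>)"
    using MVT2[OF zero_less_one DERIV_weights[where b = b and h = h and i = i]] unfolding S_def by blast
  moreover have "\<bar>weights (b + s *\<^sub>R h) $ i * (S s i - (\<Sum>l\<in>UNIV. weights (b + s *\<^sub>R h) $ l * S s l))\<bar>
      \<le> 1 * (2 * norm h)"
    unfolding abs_mult
  proof (intro mult_mono prob_simplex_le_1 weights_simplex)
    have S: "\<bar>S s i\<bar> \<le> norm h" for i
      unfolding S_def by (rule abs_plan_average_le(2)[OF w_pos w_sum plans_simplex])
    show "\<bar>S s i - (\<Sum>l\<in>UNIV. weights (b + s *\<^sub>R h) $ l * S s l)\<bar> \<le> 2 * norm h"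
      using S[of i] abs_average_le[OF weights_simplex[of "b + s *\<^sub>R h"], where f = "S s", OF S] by linarith
  qed auto
  ultimately show ?thesis
    using \<tau>_pos by (simp add: h_def divide_right_mono)
qed

text \<open>
  The intermediate point depends on the component \<open>a\<close>, which is why all later comparisons
  with the gradient are made componentwise.
\<close>

lemma grad_mean_value:
  obtains s where "0 < s" "s < 1"
    "grad b' $ a - grad b $ a
      = hess_apply \<eta> \<tau> w (weights (b + s *\<^sub>R (b' - b))) (plans (b + s *\<^sub>R (b' - b))) (b' - b) $ a"
  using MVT2[OF zero_less_one DERIV_grad[where b = b and h = "b' - b" and a = a]] that by auto

lemma grad_Lipschitz:
  "norm (grad b' - grad b) \<le> real CARD('k \<times> 'm) * ((2 / \<tau> + 2 / \<eta>) * norm (b' - b))"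
proof (rule norm_le_card_mult)
  fix a
  show "\<bar>(grad b' - grad b) $ a\<bar> \<le> (2 / \<tau> + 2 / \<eta>) * norm (b' - b)"
  proof (rule grad_mean_value[of b' a b])
    fix s
    assume "grad b' $ a - grad b $ a
      = hess_apply \<eta> \<tau> w (weights (b + s *\<^sub>R (b' - b))) (plans (b + s *\<^sub>R (b' - b))) (b' - b) $ a"
    then show ?thesis
      using hess_apply_bound[OF \<eta>_pos \<tau>_pos w_pos w_sum weights_simplex plans_simplex] by simp
  qed
qed

end

section \<open>The regularized Newton direction\<close>

lemma subspace_V: "subspace V"
  by (simp add: subspace_def V_def blk_def sum.distrib sum_distrib_left[symmetric])

text \<open>
  In the case \<open>g \<noteq> 0\<close> the regularization makes the matrix positive definite although \<open>H\<close> has a kernel;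
  for \<open>g = 0\<close> the direction is \<open>0\<close> by convention and both sides vanish.
\<close>

lemma newton_dir_eq:
  assumes psd: "\<And>x. 0 \<le> x \<bullet> (H *v x)"
  shows "H *v newton_dir g H + norm g *\<^sub>R newton_dir g H = - g"
proof (cases "g = 0")
  case True
  then show ?thesis by (simp add: newton_dir_def)
next
  case False
  let ?A = "H + norm g *\<^sub>R mat 1"
  have A: "?A *v x = H *v x + norm g *\<^sub>R x" for x
    by (simp add: matrix_vector_mult_add_rdistrib scaleR_matrix_vector_assoc[symmetric])
  have "x = 0" if "?A *v x = 0" for x
  proof -
    have "0 = x \<bullet> (H *v x) + norm g * (x \<bullet> x)"
      using that unfolding A by (metis inner_add_right inner_scaleR_right inner_zero_right)
    moreover have "0 \<le> norm g * (x \<bullet> x)" by simp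
    ultimately have "norm g * (x \<bullet> x) = 0" using psd[of x] by linarith
    then show ?thesis using False by simp
  qed
  then have "invertible ?A"
    unfolding invertible_left_inverse matrix_left_invertible_ker by blast
  then have "?A ** matrix_inv ?A = mat 1"
    unfolding invertible_def matrix_inv_def by (rule someI2_ex) simp
  then have "?A *v (matrix_inv ?A *v g) = g"
    by (simp add: matrix_vector_mul_assoc)
  then show ?thesis
    using False unfolding A[symmetric] newton_dir_def
    by (simp add: linear_neg[OF matrix_vector_mul_linear])
qed

text \<open>
  The equation expresses \<open>norm g *\<^sub>R d\<close> by vectors of \<open>W\<close>. Applied with \<open>W = V\<close>, this keeps the
  iterates in the subspace on which the Hessian is coercive.
\<close>

lemma newton_dir_in_subspace:
  assumes psd: "\<And>x. 0 \<le> x \<bullet> (H *v x)" and W: "subspace W"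
    and "g \<in> W" and H: "\<And>x. H *v x \<in> W"
  shows "newton_dir g H \<in> W"
proof (cases "g = 0")
  case True
  then show ?thesis using W by (simp add: newton_dir_def subspace_0)
next
  case False
  have "norm g *\<^sub>R newton_dir g H = - g - H *v newton_dir g H"
    using newton_dir_eq[OF psd, of g] by (simp add: algebra_simps)
  then have "norm g *\<^sub>R newton_dir g H \<in> W"
    using assms by (simp add: subspace_diff subspace_neg)
  then have "(1 / norm g) *\<^sub>R (norm g *\<^sub>R newton_dir g H) \<in> W"
    by (rule subspace_scale[OF W])
  then show ?thesis using False by simp
qed

text \<open>
  The new error \<open>z\<close> solves \<open>(H + \<parallel>g\<parallel>I) z = (H e - g) + \<parallel>g\<parallel>e\<close>. Testing with \<open>z\<close> and
  discarding \<open>\<parallel>g\<parallel> \<parallel>z\<parallel>\<^sup>2\<close> leaves the coercivity of \<open>H\<close> against a quadratically small right-hand side.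
\<close>

lemma newton_step_quadratic:
  assumes \<kappa>: "0 < \<kappa>" "\<kappa> * (norm (e + newton_dir g H))\<^sup>2 \<le> (e + newton_dir g H) \<bullet> (H *v (e + newton_dir g H))"
    and psd: "\<And>x. 0 \<le> x \<bullet> (H *v x)"
    and res: "norm (H *v e - g) \<le> M * (norm e)\<^sup>2" and g: "norm g \<le> G * norm e"
  shows "norm (e + newton_dir g H) \<le> (M + G) / \<kappa> * (norm e)\<^sup>2"
proof -
  define z where "z = e + newton_dir g H"
  define r where "r = (H *v e - g) + norm g *\<^sub>R e"
  have z: "H *v z + norm g *\<^sub>R z = r"
    using newton_dir_eq[OF psd, of g] by (simp add: z_def r_def matrix_vector_right_distrib algebra_simps)
  have "norm r \<le> M * (norm e)\<^sup>2 + norm g * norm e"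
    unfolding r_def using res by (intro norm_triangle_le) simp
  also have "norm g * norm e \<le> G * norm e * norm e"
    using g by (intro mult_right_mono) auto
  finally have r: "norm r \<le> (M + G) * (norm e)\<^sup>2"
    by (simp add: power2_eq_square algebra_simps)
  have "norm z * (\<kappa> * norm z) = \<kappa> * (norm z)\<^sup>2"
    by (simp add: power2_eq_square)
  also have "\<dots> \<le> z \<bullet> (H *v z)"
    using \<kappa>(2) by (simp add: z_def)
  also have "\<dots> \<le> z \<bullet> r"
    unfolding z[symmetric] by (simp add: inner_add_right)
  also have "\<dots> \<le> norm z * norm r"
    by (rule norm_cauchy_schwarz)
  finally have "z = 0 \<or> \<kappa> * norm z \<le> norm r"
    by (auto simp: mult_le_cancel_left)
  then have "\<kappa> * norm z \<le> norm r" by auto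
  with r have "\<kappa> * norm z \<le> (M + G) * (norm e)\<^sup>2" by linarith
  then show ?thesis using \<kappa>(1) by (simp add: z_def field_simps)
qed

section \<open>Local quadratic convergence\<close>

context wasserstein_barycenter
begin

abbreviation hess :: "real \<Rightarrow> 'n \<Rightarrow> real ^ ('k \<times> 'm) \<Rightarrow> real ^ ('k \<times> 'm) ^ ('k \<times> 'm)" where
  "hess \<rho> i0 b \<equiv> sparse_hessian \<eta> \<tau> \<mu> C w \<pi> \<rho> i0 b"

definition sparsifiable :: "real \<Rightarrow> 'n \<Rightarrow> real ^ ('k \<times> 'm) \<Rightarrow> bool" where
  "sparsifiable \<rho> i0 b \<longleftrightarrow> (\<forall>k i. i \<noteq> i0 \<longrightarrow> kept_mass \<rho> (plans b k) i \<noteq> 0)"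

lemma sparsified_simplex:
  "sparsifiable \<rho> i0 b \<Longrightarrow> sparsify \<rho> i0 (plans b k) $ i \<in> prob_simplex"
  by (intro sparsify_in_prob_simplex plans_simplex) (auto simp: sparsifiable_def)

lemma hess_psd:
  assumes "sparsifiable \<rho> i0 b"
  shows "0 \<le> x \<bullet> (hess \<rho> i0 b *v x)"
  unfolding sparse_hessian_mult_eq
  by (rule hess_apply_nonneg[OF \<eta>_pos \<tau>_pos weights_simplex sparsified_simplex[OF assms]
        less_imp_le[OF w_pos]])

lemma hess_in_V: "sparsifiable \<rho> i0 b \<Longrightarrow> hess \<rho> i0 b *v x \<in> V"
  unfolding sparse_hessian_mult_eq by (intro hess_apply_in_V weights_simplex sparsified_simplex)

lemma max_weight_ge:
  assumes "\<And>i. weights b $ i \<le> weights b $ i0"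
  shows "1 / real CARD('n) \<le> weights b $ i0"
proof -
  have "1 = (\<Sum>i\<in>UNIV. weights b $ i)"
    using prob_simplexD(2)[OF weights_simplex] by simp
  also have "\<dots> \<le> (\<Sum>i::'n\<in>UNIV. weights b $ i0)"
    using assms by (intro sum_mono)
  finally show ?thesis by (simp add: field_simps)
qed

text \<open>
  The plans at \<open>b0\<close> have a smallest entry \<open>p > 0\<close>. The radius is chosen so that, by their Lipschitz
  constant \<open>2/\<eta>\<close>, plans move by at most \<open>p/2\<close>; row \<open>i0\<close> is not sparsified and keeps this lower bound.
\<close>

lemma hess_coercive_near:
  obtains \<kappa> \<delta> where "0 < \<kappa>" "0 < \<delta>"
    and "\<And>b \<rho> i0 x. norm (b - b0) \<le> \<delta> \<Longrightarrow> (\<And>i. weights b $ i \<le> weights b $ i0) \<Longrightarrow>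
          sparsifiable \<rho> i0 b \<Longrightarrow> x \<in> V \<Longrightarrow> \<kappa> * (norm x)\<^sup>2 \<le> x \<bullet> (hess \<rho> i0 b *v x)"
proof -
  define w0 where "w0 = Min (range w)"
  define p where "p = Min (range (\<lambda>(k, i, j). plans b0 k $ i $ j))"
  have w0: "0 < w0" "\<And>k. w0 \<le> w k"
    using w_pos by (auto simp: w0_def)
  have p0: "0 < p"
    unfolding p_def by (subst Min_gr_iff) (auto simp: plans_pos)
  have p: "p \<le> plans b0 k $ i $ j" for k i j
    unfolding p_def by (rule Min_le) (auto intro: rev_image_eqI[of "(k, i, j)"])
  show ?thesis
  proof
    show "0 < w0 * (1 / real CARD('n)) * (p / 2) / \<eta>"
      using w0 p0 \<eta>_pos by simp
    show "0 < p * \<eta> / 4"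
      using p0 \<eta>_pos by simp
    fix b \<rho> i0 and x :: "real ^ ('k \<times> 'm)"
    assume b: "norm (b - b0) \<le> p * \<eta> / 4" and i0: "\<And>i. weights b $ i \<le> weights b $ i0"
      and sp: "sparsifiable \<rho> i0 b" and x: "x \<in> V"
    have "2 / \<eta> * norm (b - b0) \<le> p / 2"
      using b \<eta>_pos by (simp add: field_simps)
    then have "p / 2 \<le> plans b k $ i $ j" for k i j
      using plans_Lipschitz[where b' = b and b = b0 and k = k and i = i and j = j] p[of k i j] by linarith
    then have "p / 2 \<le> sparsify \<rho> i0 (plans b k) $ i0 $ j" for k j
      by (simp add: sparsify_def)
    then show "w0 * (1 / real CARD('n)) * (p / 2) / \<eta> * (norm x)\<^sup>2 \<le> x \<bullet> (hess \<rho> i0 b *v x)"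
      unfolding sparse_hessian_mult_eq
      using w0 p0 max_weight_ge[OF i0] x
      by (intro hess_apply_coercive[OF \<eta>_pos \<tau>_pos weights_simplex sparsified_simplex[OF sp]]) auto
  qed
qed

text \<open>
  By the mean value theorem each component of the gradient is a component of \<open>hess_apply\<close> at an
  intermediate point \<open>\<xi>\<close>, so the residual is the effect of replacing the weights and plans at \<open>\<xi>\<close> by the
  weights and sparsified plans at \<open>b\<close>. Both changes are linear in the error, because
  \<open>norm (b - \<xi>) \<le> norm (b - b0)\<close> and because the threshold is proportional to the gradient.
\<close>

lemma hess_residual:
  assumes C\<rho>: "0 \<le> C\<rho>" and b0: "grad b0 = 0"
  obtains M where "\<And>b i0. sparsifiable (C\<rho> * norm (grad b)) i0 b \<Longrightarrow>
      norm (hess (C\<rho> * norm (grad b)) i0 b *v (b - b0) - grad b) \<le> M * (norm (b - b0))\<^sup>2"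
proof -
  define m n N where "m = real CARD('m)" and "n = real CARD('n)" and "N = real CARD('k \<times> 'm)"
  define G where "G = N * (2 / \<tau> + 2 / \<eta>)"
  define E where "E = m * (C\<rho> * G) + (2 / \<tau> + 2 / \<eta>)"
  define D where "D = n * (4 + m + n * (1 + m)) / \<tau> + n * (4 + m) / \<eta>"
  have "norm (hess (C\<rho> * norm (grad b)) i0 b *v (b - b0) - grad b) \<le> N * D * E * (norm (b - b0))\<^sup>2"
    if sp: "sparsifiable (C\<rho> * norm (grad b)) i0 b" for b i0
  proof -
    define e where "e = b - b0"
    define \<rho> where "\<rho> = C\<rho> * norm (grad b)"
    define Q where "Q k = sparsify \<rho> i0 (plans b k)" for k
    have Q: "Q k $ i \<in> prob_simplex" for k i
      unfolding Q_def \<rho>_def by (rule sparsified_simplex[OF sp])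
    have "norm (grad b) \<le> G * norm e"
      using grad_Lipschitz[of b b0] by (simp add: b0 G_def N_def e_def mult.assoc)
    then have \<rho>: "0 \<le> \<rho>" "m * \<rho> \<le> m * (C\<rho> * G) * norm e"
      using C\<rho> by (auto simp: \<rho>_def m_def mult.assoc intro!: mult_left_mono)
    have pos: "0 \<le> 2 / \<tau> * norm e" "0 \<le> 2 / \<eta> * norm e" "0 \<le> m * (C\<rho> * G) * norm e"
      using \<tau>_pos \<eta>_pos C\<rho> by (auto simp: m_def G_def N_def)
    have E: "E * norm e = m * (C\<rho> * G) * norm e + 2 / \<tau> * norm e + 2 / \<eta> * norm e"
      by (simp add: E_def distrib_right)
    have "\<bar>(hess \<rho> i0 b *v e - grad b) $ a\<bar> \<le> D * (E * norm e) * norm e" for a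
    proof (rule grad_mean_value[of b a b0])
      fix s :: real
      assume s: "0 < s" "s < 1"
      define \<xi> where "\<xi> = b0 + s *\<^sub>R e"
      assume "grad b $ a - grad b0 $ a
        = hess_apply \<eta> \<tau> w (weights (b0 + s *\<^sub>R (b - b0))) (plans (b0 + s *\<^sub>R (b - b0))) (b - b0) $ a"
      then have g: "grad b $ a = hess_apply \<eta> \<tau> w (weights \<xi>) (plans \<xi>) e $ a"
        by (simp add: b0 \<xi>_def e_def)
      have "b - \<xi> = (1 - s) *\<^sub>R e"
        by (simp add: \<xi>_def e_def algebra_simps)
      then have "norm (b - \<xi>) \<le> norm e"
        using s by (simp add: mult_left_le_one_le)
      then have le: "2 / \<tau> * norm (b - \<xi>) \<le> 2 / \<tau> * norm e" "2 / \<eta> * norm (b - \<xi>) \<le> 2 / \<eta> * norm e"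
        using \<tau>_pos \<eta>_pos by (simp_all add: divide_right_mono)
      have dv: "\<bar>weights b $ i - weights \<xi> $ i\<bar> \<le> E * norm e" for i
        using weights_Lipschitz[where b' = b and b = \<xi> and i = i] le(1) pos unfolding E by linarith
      have dQ: "\<bar>Q k $ i $ j - plans \<xi> k $ i $ j\<bar> \<le> E * norm e" for k i j
      proof -
        have "\<bar>Q k $ i $ j - plans b k $ i $ j\<bar> \<le> m * \<rho>"
          unfolding Q_def m_def using sp \<rho>(1)
          by (intro sparsify_error plans_simplex) (auto simp: sparsifiable_def \<rho>_def)
        then show ?thesis
          using plans_Lipschitz[where b' = b and b = \<xi> and k = k and i = i and j = j] le(2) pos \<rho>(2) unfolding E by linarith
      qed
      show ?thesis
        using hess_apply_Lipschitz[OF \<eta>_pos \<tau>_pos w_pos w_sum weights_simplex weights_simplex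
            Q plans_simplex dv dQ, where x = e and a = a]
        by (simp add: sparse_hessian_mult_eq g D_def n_def m_def flip: Q_def)
    qed
    then have "norm (hess \<rho> i0 b *v e - grad b) \<le> N * (D * (E * norm e) * norm e)"
      unfolding N_def by (rule norm_le_card_mult)
    then show ?thesis
      by (simp add: \<rho>_def e_def power2_eq_square mult_ac)
  qed
  then show ?thesis by (rule that)
qed

end

theorem theorem5p3:
  fixes \<mu> :: "'k::finite \<Rightarrow> real ^ 'm::finite"
    and C :: "'k \<Rightarrow> real ^ 'm ^ 'n::finite"
    and w :: "'k \<Rightarrow> real"
    and \<pi> :: "real ^ 'n"
    and \<eta> \<tau> C\<rho> \<sigma> c :: real
    and istar :: "nat \<Rightarrow> 'n"
    and s :: "nat \<Rightarrow> real"
    and \<beta> :: "nat \<Rightarrow> real ^ ('k \<times> 'm)"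
    and \<beta>star :: "real ^ ('k \<times> 'm)"
  assumes "\<eta> > 0" and "\<tau> > 0"
    and "\<And>k. \<mu> k \<in> prob_simplex" and "\<And>k j. \<mu> k $ j > 0"
    and "\<And>k i j. C k $ i $ j \<ge> 0"
    and "\<And>k. w k > 0" and "(\<Sum>k\<in>UNIV. w k) = 1"
    and "\<pi> \<in> prob_simplex" and "\<And>i. \<pi> $ i > 0"
    and "C\<rho> \<ge> 0"
    and "0 < \<sigma>" and "\<sigma> < 1 / 2"
    and "0 < c" and "c < 1"
    and iterates: "newton_wb_iterates \<eta> \<tau> \<mu> C w \<pi> C\<rho> \<sigma> c istar s \<beta>"
    and minimizer: "is_arg_min (dual_loss \<eta> \<tau> \<mu> C w \<pi>) (\<lambda>x. x \<in> V) \<beta>star"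
  shows "\<exists>\<delta>>0. \<exists>M>0. \<forall>t.
           norm (\<beta> t - \<beta>star) \<le> \<delta> \<and> s t = 1 \<longrightarrow>
           norm (\<beta> (Suc t) - \<beta>star) \<le> M * (norm (\<beta> t - \<beta>star))\<^sup>2"
proof -
  interpret wasserstein_barycenter \<eta> \<tau> \<mu> C w \<pi>
    using assms by unfold_locales
  define \<rho> where "\<rho> t = C\<rho> * norm (grad (\<beta> t))" for t
  define H where "H t = hess (\<rho> t) (istar t) (\<beta> t)" for t
  define d where "d t = newton_dir (grad (\<beta> t)) (H t)" for t
  have init: "\<beta> 0 \<in> V"
    and max: "weights (\<beta> t) $ i \<le> weights (\<beta> t) $ istar t"
    and sp: "sparsifiable (\<rho> t) (istar t) (\<beta> t)"
    and step: "\<beta> (Suc t) = \<beta> t + s t *\<^sub>R d t" for t i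
    using iterates
    unfolding newton_wb_iterates_def Let_def sparsifiable_def \<rho>_def d_def H_def by blast+
  have psd: "0 \<le> x \<bullet> (H t *v x)" for t x
    unfolding H_def by (rule hess_psd[OF sp])
  have dV: "d t \<in> V" for t
    unfolding d_def
    by (rule newton_dir_in_subspace[OF psd subspace_V grad_in_V]) (simp add: H_def hess_in_V[OF sp])
  have \<beta>V: "\<beta> t \<in> V" for t
    by (induction t) (simp_all add: init step dV subspace_V subspace_add subspace_scale)
  have \<beta>starV: "\<beta>star \<in> V" and g0: "grad \<beta>star = 0"
    using minimizer grad_eq_0_at_minimizer by (auto simp: is_arg_min_def)
  obtain \<kappa> \<delta> where \<kappa>: "0 < \<kappa>" and \<delta>: "0 < \<delta>"
    and coercive: "\<And>b \<rho> i0 x. norm (b - \<beta>star) \<le> \<delta> \<Longrightarrow> (\<And>i. weights b $ i \<le> weights b $ i0) \<Longrightarrow>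
          sparsifiable \<rho> i0 b \<Longrightarrow> x \<in> V \<Longrightarrow> \<kappa> * (norm x)\<^sup>2 \<le> x \<bullet> (hess \<rho> i0 b *v x)"
    using hess_coercive_near[of \<beta>star] by blast
  obtain M where residual: "\<And>b i0. sparsifiable (C\<rho> * norm (grad b)) i0 b \<Longrightarrow>
      norm (hess (C\<rho> * norm (grad b)) i0 b *v (b - \<beta>star) - grad b) \<le> M * (norm (b - \<beta>star))\<^sup>2"
    using hess_residual[OF \<open>C\<rho> \<ge> 0\<close> g0] by blast
  define G where "G = real CARD('k \<times> 'm) * (2 / \<tau> + 2 / \<eta>)"
  \<comment> \<open>the bound needs a positive constant even if \<open>M\<close> is negative\<close>
  define K where "K = \<bar>(M + G) / \<kappa>\<bar> + 1"
  have "norm (\<beta> (Suc t) - \<beta>star) \<le> K * (norm (\<beta> t - \<beta>star))\<^sup>2"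
    if near: "norm (\<beta> t - \<beta>star) \<le> \<delta>" and s: "s t = 1" for t
  proof -
    define e where "e = \<beta> t - \<beta>star"
    have "e + d t \<in> V"
      using \<beta>V \<beta>starV dV by (simp add: e_def subspace_V subspace_add subspace_diff)
    then have "\<kappa> * (norm (e + d t))\<^sup>2 \<le> (e + d t) \<bullet> (H t *v (e + d t))"
      unfolding H_def by (rule coercive[OF near max sp])
    moreover have "norm (H t *v e - grad (\<beta> t)) \<le> M * (norm e)\<^sup>2"
      using residual sp unfolding H_def \<rho>_def e_def .
    moreover have "norm (grad (\<beta> t)) \<le> G * norm e"
      using grad_Lipschitz[of "\<beta> t" \<beta>star] by (simp add: g0 G_def e_def mult.assoc)
    ultimately have "norm (e + d t) \<le> (M + G) / \<kappa> * (norm e)\<^sup>2"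
      unfolding d_def using newton_step_quadratic[OF \<kappa> _ psd] by blast
    also have "\<dots> \<le> K * (norm e)\<^sup>2"
      unfolding K_def using abs_ge_self[of "(M + G) / \<kappa>"] by (intro mult_right_mono) (linarith, simp)
    finally show ?thesis
      by (simp add: e_def step s algebra_simps)
  qed
  moreover have "0 < K"
    by (simp add: K_def add_nonneg_pos)
  ultimately show ?thesis
    using \<delta> by blast
qed

end
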